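(* Let $\Gamma$ be a Fuchsian group acting on the Poincaré disc $B^2$, and let $p\in S^1$ be a geodesic separation point of $\Gamma$. Then $p$ is a conical limit point of $\Gamma$.
   Context: A Fuchsian group is a discrete group of Möbius transformations acting on the Poincaré disc $B^2$, and hence also on the circle at infinity $S^1=\partial B^2$. Neighborhoods of points in $S^1$ are taken to be open subsets of $S^1$. An open set $U\subseteq S^1$ can be concentrated at $p\in S^1$ if for every neighborhood $V$ of $p$ in $S^1$ there exists $\gamma\in\Gamma$ such that $p\in\gamma(U)$ and $\gamma(U)\subseteq V$. A limit point $p$ of $\Gamma$ is a geodesic separation point for $\Gamma$ if for every sufficiently small connected neighborhood $U$ of $p$ (i.e. there is a neighborhood $W$ of $p$ such that for every connected neighborhood $U$ of $p$ with $U\subseteq W$), either $U$ or $S^1-\overline{U}$ can be concentrated at $p$. A limit point $p$ of $\Gamma$ is a conical limit point if there is a sequence of translates $\gamma_n(0)$, $\gamma_n\in\Gamma$, of the origin $0\in B^2$ that converges to $p$ (in the Euclidean topology of the closed disc) and lies within a bounded hyperbolic distance of a geodesic ray ending at $p$. *)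

theory Defs
  imports "HOL-Complex_Analysis.Complex_Analysis" "HOL-Algebra.Bij"
begin

text \<open>
  The Poincare disc \<open>B\<^sup>2\<close> is \<open>ball 0 1\<close> and its circle at infinity \<open>S\<^sup>1\<close> is \<open>sphere 0 1\<close>, in the
  complex plane. The orientation-preserving Moebius transformations preserving the disc are the
  maps \<^const>\<open>Moebius_function\<close> \<open>t a\<close> with \<open>norm a < 1\<close>; their restrictions to the closed disc avoid
  the pole \<open>1 / cnj a\<close>, where the library's total function is not the Moebius map.
\<close>

definition disc_moebius :: "(complex \<Rightarrow> complex) set" where
  "disc_moebius =
     {restrict (Moebius_function t a) (cball 0 1) | t a. norm a < 1}"

text \<open>Discreteness is with respect to uniform convergence on the closed disc.\<close>

definition fuchsian_group :: "(complex \<Rightarrow> complex) set \<Rightarrow> bool" where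
  "fuchsian_group \<Gamma> \<longleftrightarrow>
     subgroup \<Gamma> (BijGroup (cball 0 1)) \<and>
     \<Gamma> \<subseteq> disc_moebius \<and>
     (\<forall>g\<in>\<Gamma>. \<exists>e>0. \<forall>h\<in>\<Gamma>. (\<forall>z\<in>cball 0 1. dist (g z) (h z) < e) \<longrightarrow> h = g)"

definition limit_point :: "(complex \<Rightarrow> complex) set \<Rightarrow> complex \<Rightarrow> bool" where
  "limit_point \<Gamma> p \<longleftrightarrow> p \<in> sphere 0 1 \<and> (\<exists>z\<in>ball 0 1. p islimpt ((\<lambda>g. g z) ` \<Gamma>))"

definition circle_neighborhood :: "complex set \<Rightarrow> complex \<Rightarrow> bool" where
  "circle_neighborhood V p \<longleftrightarrow> openin (top_of_set (sphere 0 1)) V \<and> p \<in> V"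

definition can_be_concentrated ::
    "(complex \<Rightarrow> complex) set \<Rightarrow> complex set \<Rightarrow> complex \<Rightarrow> bool" where
  "can_be_concentrated \<Gamma> U p \<longleftrightarrow>
     openin (top_of_set (sphere 0 1)) U \<and> p \<in> sphere 0 1 \<and>
     (\<forall>V. circle_neighborhood V p \<longrightarrow> (\<exists>g\<in>\<Gamma>. p \<in> g ` U \<and> g ` U \<subseteq> V))"

definition geodesic_separation_point :: "(complex \<Rightarrow> complex) set \<Rightarrow> complex \<Rightarrow> bool" where
  "geodesic_separation_point \<Gamma> p \<longleftrightarrow>
     limit_point \<Gamma> p \<and>
     (\<exists>W. circle_neighborhood W p \<and>
        (\<forall>U. circle_neighborhood U p \<and> connected U \<and> U \<subseteq> W \<longrightarrow>
           can_be_concentrated \<Gamma> U p \<or> can_be_concentrated \<Gamma> (sphere 0 1 - closure U) p))"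

text \<open>
  Distance on \<open>ball 0 1\<close> of the Poincare metric \<open>2 |dz| / (1 - |z|\<^sup>2)\<close> (curvature \<open>-1\<close>).
\<close>

definition hyperbolic_dist :: "complex \<Rightarrow> complex \<Rightarrow> real" where
  "hyperbolic_dist z w =
     arcosh (1 + 2 * (norm (z - w))\<^sup>2 / ((1 - (norm z)\<^sup>2) * (1 - (norm w)\<^sup>2)))"

text \<open>A geodesic ray is parametrised by hyperbolic arc length on \<open>[0, \<infinity>)\<close>.\<close>

definition geodesic_ray :: "(real \<Rightarrow> complex) \<Rightarrow> bool" where
  "geodesic_ray r \<longleftrightarrow>
     (\<forall>t\<ge>0. r t \<in> ball 0 1) \<and>
     (\<forall>s\<ge>0. \<forall>t\<ge>0. hyperbolic_dist (r s) (r t) = \<bar>s - t\<bar>)"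

definition conical_limit_point :: "(complex \<Rightarrow> complex) set \<Rightarrow> complex \<Rightarrow> bool" where
  "conical_limit_point \<Gamma> p \<longleftrightarrow>
     limit_point \<Gamma> p \<and>
     (\<exists>g :: nat \<Rightarrow> complex \<Rightarrow> complex.
        (\<forall>n. g n \<in> \<Gamma>) \<and> (\<lambda>n. g n 0) \<longlonglongrightarrow> p \<and>
        (\<exists>r C. geodesic_ray r \<and> (r \<longlongrightarrow> p) at_top \<and>
           (\<forall>n. \<exists>t\<ge>0. hyperbolic_dist (g n 0) (r t) \<le> C)))"

end

theory Submission
  imports Defs
begin

text \<open>
  The proof looks at a concentrating element \<open>g\<close>, which squeezes an open set \<open>X\<close> of the circle into a
  small neighbourhood of \<open>p\<close> containing \<open>p\<close>, through two points: the pullback \<open>y\<close> of \<open>p\<close>, which lies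
  in \<open>X\<close>, and the orbit point \<open>w\<close> that \<open>g\<close> sends to the centre. Squeezing forces \<open>w\<close> towards the
  circle. The inverse of \<open>g\<close> sends the ray from the centre to \<open>p\<close> to the geodesic ray from \<open>w\<close> to
  \<open>y\<close>. If \<open>w\<close> and \<open>y\<close> stay apart along a sequence of such elements, this ray comes within
  bounded distance of the centre, and \<open>p\<close> is conical (\<open>conical_limit_pointI\<close>). So assume that \<open>p\<close> is not conical; then
  \<open>w\<close> and \<open>y\<close> merge.

  Away from \<open>w\<close> the map \<open>g\<close> contracts the circle to a small set. If \<open>y\<close> stayed in a compact part of
  \<open>X\<close>, then \<open>w\<close> would stay away from the complement of \<open>X\<close>, so \<open>X\<close> and its complement would both be
  squeezed, which is absurd (\<open>concentration_avoids_compact\<close>). Hence \<open>y\<close> accumulates at a frontier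
  point \<open>a\<close> of \<open>X\<close>, and so does \<open>w\<close>. This cannot happen when \<open>a\<close> is not a limit point. It cannot
  happen either when \<open>a\<close> is fixed by a nontrivial group element \<open>h\<close>: on the side of \<open>a\<close> containing
  \<open>y\<close>, a power of \<open>h\<close> brings \<open>y\<close> back to a compact fundamental domain, and composing \<open>g\<close> with the
  opposite power gives an element that still squeezes an arc next to \<open>a\<close>, which returns us to the
  compact case (\<open>concentration_avoids_end_arc\<close>). Thus no open set with finitely many frontier points,
  all of one of these two kinds, can be concentrated at \<open>p\<close>
  (\<open>no_concentration_at_nonconical_point\<close>).

  Such points \<open>a\<close> are dense (\<open>flexible_points_dense\<close>): near a limit point moved by the group there is
  an element that contracts a small arc into itself and has a fixed point in it. Hence
  there are arbitrarily small arcs around \<open>p\<close> with both end points of these kinds. Neither such an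
  arc nor the complement of its closure can be concentrated at \<open>p\<close>, so \<open>p\<close> is not a geodesic
  separation point.
\<close>

section \<open>Fuchsian groups acting on the closed disc\<close>

lemma one_minus_cnj_mult_nonzero:
  fixes w z :: complex
  assumes "norm w < 1" "norm z \<le> 1"
  shows "1 - cnj w * z \<noteq> 0"
proof
  assume "1 - cnj w * z = 0"
  then have "norm (cnj w * z) = 1"
    by (metis eq_iff_diff_eq_0 norm_one)
  moreover have "norm (cnj w * z) \<le> norm w * 1"
    using assms by (simp add: norm_mult mult_left_le)
  ultimately show False
    using assms by simp
qed

lemma norm_one_minus_cnj_mult:
  fixes w z :: complex
  assumes "norm z = 1"
  shows "norm (1 - cnj w * z) = norm (z - w)"
proof -
  have "z * cnj z = 1"
    using assms by (simp add: complex_norm_square[symmetric])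
  then have "1 - cnj w * z = z * cnj (z - w)"
    by (simp add: algebra_simps)
  then show ?thesis
    using assms by (metis complex_mod_cnj mult_1 norm_mult)
qed

lemma one_minus_square_le:
  fixes x d :: real
  assumes "1 - x \<le> d" shows "1 - x\<^sup>2 \<le> 2 * d"
proof -
  have "0 \<le> (1 - x)\<^sup>2"
    by simp
  then have "1 - x\<^sup>2 \<le> 2 * (1 - x)"
    by (simp add: power2_eq_square algebra_simps)
  also have "\<dots> \<le> 2 * d"
    using assms by simp
  finally show ?thesis .
qed

locale fuchsian =
  fixes \<Gamma> :: "(complex \<Rightarrow> complex) set"
  assumes fuchsian: "fuchsian_group \<Gamma>"
begin

text \<open>
  Written out as a map, because the proofs apply inverses to points; in particular
  \<open>inverse_map g 0\<close> is the point that \<open>g\<close> sends to the centre, and it locates the part of the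
  circle that \<open>g\<close> expands.
\<close>

definition inverse_map :: "(complex \<Rightarrow> complex) \<Rightarrow> complex \<Rightarrow> complex" where
  "inverse_map g = restrict (inv_into (cball 0 1) g) (cball 0 1)"

lemma Bij_of_mem: "g \<in> \<Gamma> \<Longrightarrow> g \<in> Bij (cball 0 1)"
  using fuchsian subgroup.subset[of \<Gamma> "BijGroup (cball 0 1)"]
  unfolding fuchsian_group_def by (simp add: BijGroup_def subset_eq)

lemma inverse_map_mem:
  assumes "g \<in> \<Gamma>" shows "inverse_map g \<in> \<Gamma>"
proof -
  have "subgroup \<Gamma> (BijGroup (cball 0 1))"
    using fuchsian by (simp add: fuchsian_group_def)
  then have "inv\<^bsub>BijGroup (cball 0 1)\<^esub> g \<in> \<Gamma>"
    using assms by (rule subgroup.m_inv_closed)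
  then show ?thesis
    using inv_BijGroup[OF Bij_of_mem[OF assms]] by (simp add: inverse_map_def restrict_def)
qed

lemma compose_mem:
  assumes "g \<in> \<Gamma>" "h \<in> \<Gamma>" shows "compose (cball 0 1) g h \<in> \<Gamma>"
proof -
  have "subgroup \<Gamma> (BijGroup (cball 0 1))"
    using fuchsian by (simp add: fuchsian_group_def)
  then have "g \<otimes>\<^bsub>BijGroup (cball 0 1)\<^esub> h \<in> \<Gamma>"
    using assms by (rule subgroup.m_closed)
  then show ?thesis
    using Bij_of_mem assms by (simp add: BijGroup_def)
qed

lemma identity_mem: "(\<lambda>z\<in>cball 0 1. z) \<in> \<Gamma>"
proof -
  have "subgroup \<Gamma> (BijGroup (cball 0 1))"
    using fuchsian by (simp add: fuchsian_group_def)
  then show ?thesis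
    using subgroup.one_closed[of \<Gamma> "BijGroup (cball 0 1)"] by (simp add: BijGroup_def)
qed

lemma maps_closed_disc: "g \<in> \<Gamma> \<Longrightarrow> z \<in> cball 0 1 \<Longrightarrow> g z \<in> cball 0 1"
  using Bij_imp_funcset[OF Bij_of_mem] by blast

lemma inverse_map_left: "g \<in> \<Gamma> \<Longrightarrow> z \<in> cball 0 1 \<Longrightarrow> inverse_map g (g z) = z"
  using Bij_of_mem[of g] maps_closed_disc[of g z]
  by (auto simp: inverse_map_def Bij_def bij_betw_def inv_into_f_f)

lemma inverse_map_right: "g \<in> \<Gamma> \<Longrightarrow> z \<in> cball 0 1 \<Longrightarrow> g (inverse_map g z) = z"
  using Bij_of_mem[of g]
  by (auto simp: inverse_map_def Bij_def bij_betw_def intro: f_inv_into_f)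

lemma moebius_form:
  assumes "g \<in> \<Gamma>"
  obtains e where "norm e = 1" "norm (inverse_map g 0) < 1"
    "\<And>z. z \<in> cball 0 1 \<Longrightarrow>
      g z = e * (z - inverse_map g 0) / (1 - cnj (inverse_map g 0) * z)"
proof -
  have "g \<in> disc_moebius"
    using fuchsian assms by (auto simp: fuchsian_group_def)
  then obtain t w where g: "g = restrict (Moebius_function t w) (cball 0 1)" and w: "norm w < 1"
    by (auto simp: disc_moebius_def)
  have "g w = 0"
    using w by (simp add: g Moebius_function_eq_zero)
  then have "inverse_map g 0 = w"
    using inverse_map_left[OF assms, of w] w by simp
  then show ?thesis
    using that[of "exp (\<i> * of_real t)"] w by (simp add: g Moebius_function_def)
qed

lemma norm_zero_less_1: "g \<in> \<Gamma> \<Longrightarrow> norm (inverse_map g 0) < 1"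
  by (erule moebius_form)

text \<open>
  All metric estimates below come from this identity. With \<open>w\<close> the zero of \<open>g\<close>, for points of the
  circle the two factors on the left are the distances from \<open>u\<close> and \<open>v\<close> to \<open>w\<close>, so \<open>g\<close> contracts
  strongly away from \<open>w\<close> once \<open>w\<close> is near the circle.
\<close>

lemma dist_images:
  assumes "g \<in> \<Gamma>" "u \<in> cball 0 1" "v \<in> cball 0 1"
  shows "norm (g u - g v) * norm (1 - cnj (inverse_map g 0) * u) * norm (1 - cnj (inverse_map g 0) * v)
       = norm (u - v) * (1 - (norm (inverse_map g 0))\<^sup>2)"
proof -
  define w where "w = inverse_map g 0"
  obtain e where e: "norm e = 1" "norm w < 1"
    "\<And>z. z \<in> cball 0 1 \<Longrightarrow> g z = e * (z - w) / (1 - cnj w * z)"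
    using moebius_form[OF assms(1)] unfolding w_def by metis
  have nz: "1 - cnj w * u \<noteq> 0" "1 - cnj w * v \<noteq> 0"
    using one_minus_cnj_mult_nonzero[OF e(2)] assms by auto
  have "g u * (1 - cnj w * u) = e * (u - w)" "g v * (1 - cnj w * v) = e * (v - w)"
    using nz e(3)[OF assms(2)] e(3)[OF assms(3)] by simp_all
  then have "(g u - g v) * (1 - cnj w * u) * (1 - cnj w * v) =
        e * ((u - w) * (1 - cnj w * v) - (v - w) * (1 - cnj w * u))"
    by algebra
  also have "\<dots> = e * (u - v) * (1 - w * cnj w)"
    by (simp add: algebra_simps)
  also have "1 - w * cnj w = of_real (1 - (norm w)\<^sup>2)"
    by (simp only: complex_norm_square[symmetric] of_real_diff of_real_1)
  finally have "norm (g u - g v) * norm (1 - cnj w * u) * norm (1 - cnj w * v)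
      = norm (u - v) * \<bar>1 - (norm w)\<^sup>2\<bar>"
    using e(1) by (metis norm_mult mult_1 norm_of_real)
  moreover have "(norm w)\<^sup>2 \<le> 1"
    using e(2) by (simp add: power_le_one)
  ultimately show ?thesis
    by (simp add: w_def)
qed

text \<open>
  With \<open>w\<close> the zero of \<open>g\<close>, the derivative of \<open>g\<close> at \<open>z\<close> has modulus
  \<open>(1 - (norm w)\<^sup>2) / (norm (1 - cnj w * z))\<^sup>2\<close>. So the identity expresses that \<open>g\<close> preserves the
  Poincare metric, and at points of the circle that it preserves the circle.
\<close>

lemma one_minus_norm_image:
  assumes "g \<in> \<Gamma>" "z \<in> cball 0 1"
  shows "(1 - (norm (g z))\<^sup>2) * (norm (1 - cnj (inverse_map g 0) * z))\<^sup>2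
       = (1 - (norm z)\<^sup>2) * (1 - (norm (inverse_map g 0))\<^sup>2)"
proof -
  define w where "w = inverse_map g 0"
  obtain e where e: "norm e = 1" "norm w < 1"
    "\<And>z. z \<in> cball 0 1 \<Longrightarrow> g z = e * (z - w) / (1 - cnj w * z)"
    using moebius_form[OF assms(1)] unfolding w_def by metis
  have nz: "1 - cnj w * z \<noteq> 0"
    using one_minus_cnj_mult_nonzero[OF e(2)] assms by auto
  have "norm (g z) * norm (1 - cnj w * z) = norm (z - w)"
    using nz e(1) e(3)[OF assms(2)] by (simp add: norm_mult norm_divide)
  then have "(1 - (norm (g z))\<^sup>2) * (norm (1 - cnj w * z))\<^sup>2
      = (norm (1 - cnj w * z))\<^sup>2 - (norm (z - w))\<^sup>2"
    by (metis left_diff_distrib mult_1 power_mult_distrib)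
  also have "\<dots> = (1 - (norm z)\<^sup>2) * (1 - (norm w)\<^sup>2)"
    unfolding cmod_power2 by (simp add: algebra_simps power2_eq_square)
  finally show ?thesis
    by (simp add: w_def)
qed

lemma maps_circle:
  assumes "g \<in> \<Gamma>" "z \<in> sphere 0 1" shows "g z \<in> sphere 0 1"
proof -
  have "1 - cnj (inverse_map g 0) * z \<noteq> 0"
    using one_minus_cnj_mult_nonzero[OF norm_zero_less_1[OF assms(1)]] assms by auto
  then have "(norm (g z))\<^sup>2 = 1"
    using one_minus_norm_image[of g z] assms by auto
  then show ?thesis
    by (metis mem_sphere_0 norm_ge_zero power2_eq_iff_nonneg power_one zero_le_one)
qed

lemma norm_inverse_map_0: 
  assumes "g \<in> \<Gamma>" shows "norm (inverse_map g 0) = norm (g 0)"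
proof -
  obtain e where "norm e = 1" "g 0 = e * (0 - inverse_map g 0) / (1 - cnj (inverse_map g 0) * 0)"
    using moebius_form[OF assms] by (metis centre_in_cball zero_le_one)
  then show ?thesis by (simp add: norm_mult)
qed

end

section \<open>Conical limit points in terms of group elements\<close>

lemma hyperbolic_dist_le:
  assumes "norm z < 1" "norm w < 1" "norm (z - w) \<le> K * (1 - norm z)" "norm w = norm z"
  shows "hyperbolic_dist z w \<le> arcosh (1 + 2 * K\<^sup>2)"
proof -
  have a: "1 - (norm z)\<^sup>2 \<ge> 1 - norm z" "1 - norm z > 0"
    using assms by (auto simp: power2_eq_square mult_left_le)
  have "(norm (z - w))\<^sup>2 \<le> (K * (1 - norm z))\<^sup>2"
    using assms(3) by (intro power_mono) auto
  also have "\<dots> \<le> K\<^sup>2 * ((1 - (norm z)\<^sup>2) * (1 - (norm w)\<^sup>2))"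
    unfolding power_mult_distrib assms(4)
    using a by (intro mult_left_mono) (auto simp: power2_eq_square[of "1 - norm z"] intro!: mult_mono)
  finally have "(norm (z - w))\<^sup>2 / ((1 - (norm z)\<^sup>2) * (1 - (norm w)\<^sup>2)) \<le> K\<^sup>2"
    using a assms(4) by (simp add: divide_le_eq)
  then have *: "2 * (norm (z - w))\<^sup>2 / ((1 - (norm z)\<^sup>2) * (1 - (norm w)\<^sup>2)) \<le> 2 * K\<^sup>2"
    by simp
  have nn: "0 \<le> 2 * (norm (z - w))\<^sup>2 / ((1 - (norm z)\<^sup>2) * (1 - (norm w)\<^sup>2))"
    using a assms(4) by simp
  show ?thesis
    unfolding hyperbolic_dist_def
    using * nn arcosh_less_iff_real[of "1 + 2 * K\<^sup>2"
        "1 + 2 * (norm (z - w))\<^sup>2 / ((1 - (norm z)\<^sup>2) * (1 - (norm w)\<^sup>2))"]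
    by linarith
qed

text \<open>
  The point at hyperbolic distance \<open>t\<close> from the centre has Euclidean norm \<open>tanh (t / 2)\<close>. Since
  \<open>1 - tanh\<^sup>2 = 1 / cosh\<^sup>2\<close>, the argument of \<open>arcosh\<close> becomes \<open>1 + 2 sinh\<^sup>2 ((s - t) / 2) = cosh (s - t)\<close>.
\<close>

lemma geodesic_ray_radius:
  assumes "norm p = 1"
  shows "geodesic_ray (\<lambda>t. of_real (tanh (t / 2)) * p)"
proof -
  have n: "norm (of_real (tanh (t / 2)) * p) = \<bar>tanh (t / 2)\<bar>" for t
    using assms by (simp add: norm_mult)
  have "hyperbolic_dist (of_real (tanh (s / 2)) * p) (of_real (tanh (t / 2)) * p) = \<bar>s - t\<bar>" for s t
  proof -
    have sech: "1 - (tanh x)\<^sup>2 = 1 / (cosh x)\<^sup>2" for x :: real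
    proof -
      have "(cosh x)\<^sup>2 \<noteq> 0"
        using cosh_real_pos[of x] by simp
      then have "1 - (sinh x)\<^sup>2 / (cosh x)\<^sup>2 = ((cosh x)\<^sup>2 - (sinh x)\<^sup>2) / (cosh x)\<^sup>2"
        by (simp only: diff_divide_distrib[of _ _ "(cosh x)\<^sup>2"] divide_self[of "(cosh x)\<^sup>2"] simp_thms)
      then show ?thesis
        unfolding tanh_def power_divide hyperbolic_pythagoras .
    qed
    have "norm (of_real (tanh (s / 2)) * p - of_real (tanh (t / 2)) * p) = \<bar>tanh (s / 2) - tanh (t / 2)\<bar>"
      using assms by (metis left_diff_distrib mult.right_neutral norm_mult norm_of_real of_real_diff)
    then have "hyperbolic_dist (of_real (tanh (s / 2)) * p) (of_real (tanh (t / 2)) * p)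
      = arcosh (1 + 2 * ((tanh (s / 2) - tanh (t / 2)) * cosh (s / 2) * cosh (t / 2))\<^sup>2)"
      unfolding hyperbolic_dist_def n by (simp add: sech power_mult_distrib mult.assoc)
    also have "(tanh (s / 2) - tanh (t / 2)) * cosh (s / 2) * cosh (t / 2) = sinh ((s - t) / 2)"
    proof -
      have "(tanh a - tanh b) * cosh a * cosh b = sinh (a - b)" for a b :: real
        by (simp add: tanh_def sinh_diff field_simps)
      then show ?thesis
        by (simp only: diff_divide_distrib)
    qed
    also have "1 + 2 * (sinh ((s - t) / 2))\<^sup>2 = cosh \<bar>s - t\<bar>"
    proof -
      have "cosh (s - t) = cosh (2 * ((s - t) / 2))"
        by (rule arg_cong[of _ _ cosh]) (simp add: field_simps)
      also have "\<dots> = 1 + 2 * (sinh ((s - t) / 2))\<^sup>2"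
        unfolding cosh_double_cosh cosh_square_eq by (simp add: algebra_simps)
      finally show ?thesis
        by simp
    qed
    finally show ?thesis
      using arcosh_cosh_real[of "\<bar>s - t\<bar>"] by simp
  qed
  moreover have "\<bar>tanh (t / 2)\<bar> < 1" for t :: real
    using tanh_real_bounds[of "t / 2"] by (simp add: abs_less_iff)
  ultimately show ?thesis
    unfolding geodesic_ray_def mem_ball_0 n by blast
qed

context fuchsian
begin

text \<open>
  Seen from the orbit point \<open>z = inverse_map f 0\<close>, the centre and \<open>p\<close> are placed at \<open>f 0\<close> and
  \<open>f p\<close>. If these stay a definite distance apart, the ray from the centre to \<open>p\<close> passes at bounded
  distance from \<open>z\<close>. Quantitatively \<open>norm (f p - f 0) * norm (p - z) = 1 - (norm z)\<^sup>2\<close>, so the lower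
  bound \<open>\<delta>\<close> confines \<open>z\<close> to a Stolz angle at \<open>p\<close>, and in it \<open>norm z\<close> near 1 forces \<open>z\<close> near \<open>p\<close>.
\<close>

lemma conical_limit_pointI:
  assumes "limit_point \<Gamma> p" "\<delta> > 0"
    and ex: "\<And>\<epsilon>. \<epsilon> > 0 \<Longrightarrow> \<exists>f\<in>\<Gamma>. 1 - (norm (f 0))\<^sup>2 < \<epsilon> \<and> norm (f p - f 0) \<ge> \<delta>"
  shows "conical_limit_point \<Gamma> p"
proof -
  have p: "norm p = 1"
    using assms(1) by (simp add: limit_point_def)
  have "\<forall>n. \<exists>f\<in>\<Gamma>. 1 - (norm (f 0))\<^sup>2 < \<delta> * inverse (real (Suc n)) \<and> norm (f p - f 0) \<ge> \<delta>"
    using ex assms(2) by simp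
  then obtain f where f: "\<And>n. f n \<in> \<Gamma>" "\<And>n. 1 - (norm (f n 0))\<^sup>2 < \<delta> * inverse (real (Suc n))"
      "\<And>n. norm (f n p - f n 0) \<ge> \<delta>"
    by metis
  define z where "z n = inverse_map (f n) 0" for n
  have z1: "norm (z n) < 1" for n
    unfolding z_def by (rule norm_zero_less_1[OF f(1)])
  have zf: "norm (z n) = norm (f n 0)" for n
    unfolding z_def by (rule norm_inverse_map_0[OF f(1)])
  have stolz: "\<delta> * norm (p - z n) \<le> 1 - (norm (z n))\<^sup>2" for n
  proof -
    have "norm (f n p - f n 0) * norm (p - z n) = 1 - (norm (z n))\<^sup>2"
      using dist_images[OF f(1)[of n], of p 0] p unfolding z_def
      by (simp add: norm_one_minus_cnj_mult)
    then show ?thesis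
      using mult_right_mono[OF f(3)[of n], of "norm (p - z n)"] by simp
  qed
  have near: "norm (z n - p) \<le> inverse (real (Suc n))" for n
  proof -
    have "\<delta> * norm (p - z n) \<le> \<delta> * inverse (real (Suc n))"
      using stolz[of n] f(2)[of n] by (simp add: zf)
    then show ?thesis
      using assms(2) by (simp add: norm_minus_commute)
  qed
  have "z \<longlonglongrightarrow> p"
    by (rule LIM_zero_cancel, rule Lim_null_comparison[OF _ LIMSEQ_inverse_real_of_nat])
      (use near in auto)
  moreover have "\<exists>t\<ge>0. hyperbolic_dist (z n) (of_real (tanh (t / 2)) * p) \<le> arcosh (1 + 2 * (2 / \<delta> + 1)\<^sup>2)"
    for n
  proof -
    \<comment> \<open>Compare with the point of the ray that has the same Euclidean norm as \<open>z n\<close>.\<close>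
    define t where "t = 2 * artanh (norm (z n))"
    have t: "tanh (t / 2) = norm (z n)"
    proof -
      define x where "x = norm (z n)"
      have x: "0 \<le> x" "x < 1"
        using z1[of n] by (simp_all add: x_def)
      have "exp (- 2 * artanh x) = (1 - x) / (1 + x)"
        using x by (simp add: artanh_def exp_minus)
      then have "tanh (artanh x) = (1 - (1 - x) / (1 + x)) / (1 + (1 - x) / (1 + x))"
        unfolding tanh_real_altdef by (rule arg_cong)
      also have "\<dots> = x"
        using x by (simp add: field_simps)
      finally have "tanh (artanh x) = x" .
      then show ?thesis
        by (simp add: t_def x_def)
    qed
    then have "t \<ge> 0"
      by (metis norm_ge_zero tanh_real_nonneg_iff zero_le_divide_iff zero_le_numeral not_numeral_le_zero)
    have "norm (p - of_real (norm (z n)) * p) = 1 - norm (z n)"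
    proof -
      have "p - of_real (norm (z n)) * p = of_real (1 - norm (z n)) * p"
        by (simp add: algebra_simps)
      then show ?thesis
        using z1[of n] p by (simp only: norm_mult norm_of_real) simp
    qed
    moreover have "norm (z n - of_real (norm (z n)) * p)
        \<le> norm (p - z n) + norm (p - of_real (norm (z n)) * p)"
      by (rule norm_diff_triangle_le[OF _ order_refl]) (simp add: norm_minus_commute)
    moreover have "norm (p - z n) \<le> 2 / \<delta> * (1 - norm (z n))"
    proof -
      have "1 - (norm (z n))\<^sup>2 = (1 - norm (z n)) * (1 + norm (z n))"
        by (simp add: power2_eq_square algebra_simps)
      also have "\<dots> \<le> (1 - norm (z n)) * 2"
        using z1[of n] by (intro mult_left_mono) auto
      finally show ?thesis
        using stolz[of n] assms(2) by (simp add: field_simps)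
    qed
    ultimately have "norm (z n - of_real (norm (z n)) * p) \<le> (2 / \<delta> + 1) * (1 - norm (z n))"
      by (simp add: algebra_simps)
    then have "hyperbolic_dist (z n) (of_real (tanh (t / 2)) * p) \<le> arcosh (1 + 2 * (2 / \<delta> + 1)\<^sup>2)"
      unfolding t using z1[of n] p by (intro hyperbolic_dist_le) (simp_all add: norm_mult)
    then show ?thesis
      using \<open>t \<ge> 0\<close> by blast
  qed
  moreover have "((\<lambda>t. of_real (tanh (t / 2)) * p) \<longlongrightarrow> p) at_top"
  proof -
    have "filterlim (\<lambda>t::real. t / 2) at_top at_top"
      by real_asymp
    then have "((\<lambda>t::real. tanh (t / 2)) \<longlongrightarrow> 1) at_top"
      by (rule filterlim_compose[OF tanh_real_at_top])
    from tendsto_mult[OF tendsto_of_real[OF this] tendsto_const[of p]] show ?thesis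
      by simp
  qed
  moreover have "\<forall>n. inverse_map (f n) \<in> \<Gamma>"
    using f(1) inverse_map_mem by blast
  ultimately show ?thesis
    unfolding conical_limit_point_def z_def
    apply (intro conjI exI[of _ "\<lambda>n. inverse_map (f n)"]
        exI[of _ "\<lambda>t. of_real (tanh (t / 2)) * p"] exI[of _ "arcosh (1 + 2 * (2 / \<delta> + 1)\<^sup>2)"])
    subgoal by (rule assms(1))
    subgoal by assumption
    subgoal by assumption
    subgoal by (rule geodesic_ray_radius[OF p])
    subgoal by assumption
    subgoal by simp
    done
qed

end

section \<open>Concentration at a non-conical point\<close>

context fuchsian
begin

text \<open>
  This condition expresses the failure of the criterion \<open>conical_limit_pointI\<close>, with \<open>f\<close> replaced
  by the inverse of \<open>g\<close>.
\<close>

definition nonconical_at :: "complex \<Rightarrow> bool" where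
  "nonconical_at p \<longleftrightarrow>
     (\<forall>\<delta>>0. \<exists>\<epsilon>>0. \<forall>g\<in>\<Gamma>. 1 - (norm (inverse_map g 0))\<^sup>2 < \<epsilon> \<longrightarrow>
        norm (inverse_map g p - inverse_map g 0) < \<delta>)"

lemma nonconical_atI:
  assumes "limit_point \<Gamma> p" "\<not> conical_limit_point \<Gamma> p"
  shows "nonconical_at p"
proof (rule ccontr)
  assume "\<not> nonconical_at p"
  then obtain \<delta> where \<delta>: "\<delta> > 0"
    "\<And>\<epsilon>. \<epsilon> > 0 \<Longrightarrow> \<exists>g\<in>\<Gamma>. 1 - (norm (inverse_map g 0))\<^sup>2 < \<epsilon> \<and>
        \<not> norm (inverse_map g p - inverse_map g 0) < \<delta>"
    unfolding nonconical_at_def by blast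
  have "conical_limit_point \<Gamma> p"
  proof (rule conical_limit_pointI[OF assms(1) \<delta>(1)])
    fix \<epsilon> :: real assume "\<epsilon> > 0"
    then show "\<exists>f\<in>\<Gamma>. 1 - (norm (f 0))\<^sup>2 < \<epsilon> \<and> norm (f p - f 0) \<ge> \<delta>"
      using \<delta>(2) inverse_map_mem by (metis not_less)
  qed
  then show False
    using assms(2) by simp
qed

text \<open>
  An open set of the circle contains two distinct points, and \<open>g\<close> can bring these close together
  only if the zero of \<open>g\<close> is near the circle.
\<close>

lemma small_image_imp_zero_near_circle:
  assumes "openin (top_of_set (sphere 0 1)) A" "A \<noteq> {}" "\<eta> > 0"
  obtains \<epsilon> where "\<epsilon> > 0"
    "\<And>g. g \<in> \<Gamma> \<Longrightarrow> g ` A \<subseteq> ball p \<epsilon> \<Longrightarrow> 1 - (norm (inverse_map g 0))\<^sup>2 < \<eta>"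
proof -
  obtain G where G: "open G" "A = sphere 0 1 \<inter> G"
    using assms(1) by (auto simp: openin_open)
  obtain u where u: "u \<in> A"
    using assms(2) by blast
  have "sphere (0::complex) 1 \<noteq> {x}" for x
    by (metis norm_minus_cancel mem_sphere_0 norm_one one_neq_neg_one singletonD)
  moreover have "connected (sphere (0::complex) 1)" "u \<in> sphere 0 1"
    using u G by (auto intro: connected_sphere)
  ultimately have "u islimpt sphere 0 1"
    by (intro connected_imp_perfect)
  then obtain v where v: "v \<in> A" "v \<noteq> u"
    using u G unfolding islimpt_def by blast
  show ?thesis
  proof
    show "\<eta> * norm (u - v) / 8 > 0"
      using assms(3) v by simp
    fix g assume g: "g \<in> \<Gamma>" "g ` A \<subseteq> ball p (\<eta> * norm (u - v) / 8)"
    define w where "w = inverse_map g 0"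
    have "norm w < 1"
      unfolding w_def by (rule norm_zero_less_1[OF g(1)])
    then have le2: "norm (1 - cnj w * z) \<le> 2" if "z \<in> A" for z
      using that G norm_one_minus_cnj_mult[of z w] norm_triangle_ineq4[of z w] by auto
    have "dist p (g u) < \<eta> * norm (u - v) / 8" "dist p (g v) < \<eta> * norm (u - v) / 8"
      using g(2) u v by auto
    then have "norm (g u - g v) < \<eta> * norm (u - v) / 4"
      using dist_triangle3[of "g u" "g v" p] by (simp add: dist_norm)
    have "norm (u - v) * (1 - (norm w)\<^sup>2)
        = norm (g u - g v) * norm (1 - cnj w * u) * norm (1 - cnj w * v)"
      using dist_images[OF g(1), of u v] u v G by (simp add: w_def)
    also have "\<dots> \<le> norm (g u - g v) * 2 * 2"
      using le2 u v by (intro mult_mono) auto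
    also have "\<dots> < norm (u - v) * \<eta>"
      using \<open>norm (g u - g v) < \<eta> * norm (u - v) / 4\<close> by (simp add: mult.commute)
    finally show "1 - (norm (inverse_map g 0))\<^sup>2 < \<eta>"
      using v by (simp add: w_def)
  qed
qed

text \<open>
  Suppose \<open>g\<close> squeezes \<open>A\<close> near \<open>p\<close> and pulls \<open>p\<close> back into \<open>D\<close>. As \<open>p\<close> is not conical, the zero
  of \<open>g\<close> then also lies close to \<open>D\<close>, hence at a definite distance from the complement of \<open>A\<close>, and
  \<open>g\<close> squeezes that complement as well. The two images cannot both be small, since they cover the
  circle.
\<close>

lemma concentration_avoids_compact:
  assumes "nonconical_at p" "p \<in> sphere 0 1"
    and A: "openin (top_of_set (sphere 0 1)) A" and D: "compact D" "D \<subseteq> A"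
  obtains \<epsilon> where "\<epsilon> > 0"
    "\<And>g. g \<in> \<Gamma> \<Longrightarrow> g ` A \<subseteq> ball p \<epsilon> \<Longrightarrow> inverse_map g p \<notin> D"
proof (cases "D = {}")
  case True
  then show ?thesis
    using that[of 1] by simp
next
  case False
  obtain G where G: "open G" "A = sphere 0 1 \<inter> G"
    using A by (auto simp: openin_open)
  obtain d where d: "d > 0" "(\<Union>x\<in>D. ball x d) \<subseteq> G"
    using compact_subset_open_imp_ball_epsilon_subset[OF D(1) G(1)] D(2) G(2) by blast
  obtain \<eta> where \<eta>: "\<eta> > 0" "\<And>g. g \<in> \<Gamma> \<Longrightarrow> 1 - (norm (inverse_map g 0))\<^sup>2 < \<eta> \<Longrightarrow>
        norm (inverse_map g p - inverse_map g 0) < d / 2"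
    using assms(1) d(1) unfolding nonconical_at_def by (meson half_gt_zero)
  have "A \<noteq> {}"
    using False D by blast
  obtain \<epsilon> where \<epsilon>: "\<epsilon> > 0" "\<And>g. g \<in> \<Gamma> \<Longrightarrow> g ` A \<subseteq> ball p \<epsilon> \<Longrightarrow>
      1 - (norm (inverse_map g 0))\<^sup>2 < min \<eta> (d\<^sup>2 / 8)"
    using small_image_imp_zero_near_circle[OF A \<open>A \<noteq> {}\<close>, of "min \<eta> (d\<^sup>2 / 8)" p] \<eta>(1) d(1)
    by (metis min_less_iff_conj zero_less_divide_iff zero_less_numeral zero_less_power)
  show ?thesis
  proof
    show "min 1 \<epsilon> > 0"
      using \<epsilon> by simp
    fix g assume g: "g \<in> \<Gamma>" "g ` A \<subseteq> ball p (min 1 \<epsilon>)"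
    define w where "w = inverse_map g 0"
    have w: "1 - (norm w)\<^sup>2 < \<eta>" "1 - (norm w)\<^sup>2 < d\<^sup>2 / 8"
      using \<epsilon>(2)[OF g(1)] g(2) unfolding w_def by force+
    show "inverse_map g p \<notin> D"
    proof
      assume y: "inverse_map g p \<in> D"
      have yw: "norm (inverse_map g p - w) < d / 2"
        using \<eta>(2)[OF g(1)] w(1) by (simp add: w_def)
      \<comment> \<open>The points \<open>\<i> p\<close> and \<open>- \<i> p\<close> are far from \<open>p\<close>, so \<open>g\<close> cannot have taken them from \<open>A\<close>.\<close>
      have far: "norm (inverse_map g q - w) > d / 2 \<and> inverse_map g q \<in> sphere 0 1"
        if q: "q = \<i> * p \<or> q = - \<i> * p" for q
      proof -
        have q1: "norm q = 1"
          using q assms(2) by (auto simp: norm_mult)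
        have "norm (1 - \<i>) \<ge> 1" "norm (1 + \<i>) \<ge> 1"
          by (simp_all add: cmod_def)
        moreover have "p - q = (1 - \<i>) * p \<or> p - q = (1 + \<i>) * p"
          using q by (auto simp: algebra_simps)
        ultimately have "dist p q \<ge> 1"
          using assms(2) by (auto simp: dist_norm norm_mult)
        moreover have gq: "g (inverse_map g q) = q"
          using inverse_map_right[OF g(1)] q1 by simp
        ultimately have "inverse_map g q \<notin> A"
          using g(2) by force
        moreover have s: "inverse_map g q \<in> sphere 0 1"
          using maps_circle[OF inverse_map_mem[OF g(1)]] q1 by simp
        ultimately have "inverse_map g q \<notin> ball (inverse_map g p) d"
          using d(2) y G(2) by blast
        then have "norm (inverse_map g p - inverse_map g q) \<ge> d"
          by (simp add: dist_norm)
        moreover have "norm (inverse_map g p - inverse_map g q)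
            \<le> norm (inverse_map g p - w) + norm (inverse_map g q - w)"
          by (rule norm_diff_triangle_le[OF order_refl]) (simp add: norm_minus_commute)
        ultimately show ?thesis
          using yw s by linarith
      qed
      define u v where "u = inverse_map g (\<i> * p)" and "v = inverse_map g (- \<i> * p)"
      have uv: "norm (u - w) > d / 2" "norm (v - w) > d / 2" "norm u = 1" "norm v = 1"
        using far[of "\<i> * p"] far[of "- \<i> * p"] by (auto simp: u_def v_def)
      have "g u - g v = 2 * \<i> * p"
        using inverse_map_right[OF g(1)] assms(2) by (simp add: u_def v_def norm_mult)
      then have "2 * norm (u - w) * norm (v - w) = norm (u - v) * (1 - (norm w)\<^sup>2)"
        using dist_images[OF g(1), of u v] uv assms(2)
        by (simp add: norm_one_minus_cnj_mult norm_mult flip: w_def)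
      also have "\<dots> \<le> 2 * (d\<^sup>2 / 8)"
        using w(2) norm_triangle_ineq4[of u v] uv norm_zero_less_1[OF g(1)]
        by (intro mult_mono) (auto simp: w_def power_le_one)
      finally have "norm (u - w) * norm (v - w) \<le> d\<^sup>2 / 8"
        by simp
      moreover have "norm (u - w) * norm (v - w) > d / 2 * (d / 2)"
        using uv d(1) by (intro mult_strict_mono) auto
      ultimately show False
        using mult_pos_pos[OF d(1) d(1)] by (simp add: power2_eq_square)
    qed
  qed
qed

text \<open>
  At a non-conical point the pullback of \<open>p\<close> is close to the orbit point \<open>inverse_map g 0\<close>, and
  orbit points stay away from \<open>a\<close>.
\<close>

lemma concentration_avoids_nonlimit_point:
  assumes "nonconical_at p" "openin (top_of_set (sphere 0 1)) A" "A \<noteq> {}"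
    and a: "a \<in> sphere 0 1" "\<not> limit_point \<Gamma> a"
  obtains r \<epsilon> where "r > 0" "\<epsilon> > 0"
    "\<And>g. g \<in> \<Gamma> \<Longrightarrow> g ` A \<subseteq> ball p \<epsilon> \<Longrightarrow> inverse_map g p \<notin> ball a r"
proof -
  have "\<not> a islimpt ((\<lambda>g. g 0) ` \<Gamma>)"
    using a by (auto simp: limit_point_def)
  then obtain G where G: "open G" "a \<in> G" "\<And>g. g \<in> \<Gamma> \<Longrightarrow> g 0 \<in> G \<Longrightarrow> g 0 = a"
    unfolding islimpt_def by blast
  have no: "g 0 \<notin> G" if "g \<in> \<Gamma>" for g
    using G(3)[OF that] norm_inverse_map_0[OF that] norm_zero_less_1[OF that] a(1) by auto
  obtain r where r: "r > 0" "ball a r \<subseteq> G"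
    using G open_contains_ball by blast
  obtain \<eta> where \<eta>: "\<eta> > 0" "\<And>g. g \<in> \<Gamma> \<Longrightarrow> 1 - (norm (inverse_map g 0))\<^sup>2 < \<eta> \<Longrightarrow>
        norm (inverse_map g p - inverse_map g 0) < r / 2"
    using assms(1) r(1) unfolding nonconical_at_def by (meson half_gt_zero)
  obtain \<epsilon> where \<epsilon>: "\<epsilon> > 0" "\<And>g. g \<in> \<Gamma> \<Longrightarrow> g ` A \<subseteq> ball p \<epsilon> \<Longrightarrow>
      1 - (norm (inverse_map g 0))\<^sup>2 < \<eta>"
    using small_image_imp_zero_near_circle[OF assms(2,3) \<eta>(1), of p] by blast
  show ?thesis
  proof
    show "r / 2 > 0" "\<epsilon> > 0"
      using r \<epsilon> by auto
    fix g assume g: "g \<in> \<Gamma>" "g ` A \<subseteq> ball p \<epsilon>"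
    have "norm (inverse_map g p - inverse_map g 0) < r / 2"
      using \<eta>(2) \<epsilon>(2) g by blast
    moreover have "dist a (inverse_map g 0) \<ge> r"
      using no[OF inverse_map_mem[OF g(1)]] r(2) by (meson mem_ball not_less subsetD)
    ultimately show "inverse_map g p \<notin> ball a (r / 2)"
      using dist_triangle[of a "inverse_map g 0" "inverse_map g p"] by (auto simp: dist_norm)
  qed
qed

end

section \<open>A real coordinate that makes stabilisers affine\<close>

text \<open>
  For \<open>z\<close> and \<open>a\<close> on the circle the number \<open>a / (z - a)\<close> has real part \<open>- 1 / 2\<close>, so its imaginary
  part is a coordinate identifying the circle without \<open>a\<close> with the real line. Up to a scalar this is
  the boundary map of the Cayley transform sending \<open>a\<close> to infinity; \<open>circle_point a\<close> is its inverse.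
\<close>

definition circle_coord :: "complex \<Rightarrow> complex \<Rightarrow> real" where
  "circle_coord a z = Im (a / (z - a))"

definition circle_point :: "complex \<Rightarrow> real \<Rightarrow> complex" where
  "circle_point a t = a + a / Complex (- 1 / 2) t"

lemma circle_coord_eq:
  assumes "a \<in> sphere 0 1" "z \<in> sphere 0 1" "z \<noteq> a"
  shows "a / (z - a) = Complex (- 1 / 2) (circle_coord a z)"
proof -
  have "norm a = 1" "norm z = 1"
    using assms by auto
  then have n: "(Re a)\<^sup>2 + (Im a)\<^sup>2 = 1" "(Re z)\<^sup>2 + (Im z)\<^sup>2 = 1"
    by (metis cmod_power2 power_one)+
  have "Re (a / (z - a)) = (Re a * (Re z - Re a) + Im a * (Im z - Im a)) / ((Re z - Re a)\<^sup>2 + (Im z - Im a)\<^sup>2)"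
    by (simp add: Re_divide)
  moreover have "(Re z - Re a)\<^sup>2 + (Im z - Im a)\<^sup>2 \<noteq> 0"
    using assms(3) by (simp add: sum_power2_eq_zero_iff complex_eq_iff)
  moreover have "(Re z - Re a)\<^sup>2 + (Im z - Im a)\<^sup>2 = - 2 * (Re a * (Re z - Re a) + Im a * (Im z - Im a))"
    using n by (simp add: power2_eq_square algebra_simps)
  moreover have "S / D = - 1 / 2" if "D = - 2 * S" "D \<noteq> 0" for S D :: real
    using that by simp
  ultimately have "Re (a / (z - a)) = - 1 / 2"
    by metis
  then show ?thesis
    by (simp add: circle_coord_def complex_eq_iff)
qed

lemma Complex_half_nonzero: "Complex (- 1 / 2) t \<noteq> 0"
  by (simp add: complex_eq_iff)

lemma circle_point_in_circle:
  assumes "a \<in> sphere 0 1"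
  shows "circle_point a t \<in> sphere 0 1" "circle_point a t \<noteq> a"
proof -
  have "circle_point a t = a * (Complex (1 / 2) t / Complex (- 1 / 2) t)"
  proof -
    have "Complex (1 / 2) t = 1 + Complex (- 1 / 2) t"
      by (simp add: complex_eq_iff)
    then show ?thesis
      using Complex_half_nonzero[of t] by (simp add: circle_point_def field_simps)
  qed
  moreover have "norm (Complex (1 / 2) t) = norm (Complex (- 1 / 2) t)"
    by (simp add: cmod_def power2_eq_square)
  ultimately show "circle_point a t \<in> sphere 0 1"
    using assms Complex_half_nonzero[of t] by (simp add: norm_mult norm_divide)
  show "circle_point a t \<noteq> a"
    using assms Complex_half_nonzero[of t] by (auto simp: circle_point_def)
qed

lemma circle_coord_circle_point:
  assumes "a \<in> sphere 0 1" shows "circle_coord a (circle_point a t) = t"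
  using assms Complex_half_nonzero[of t] by (auto simp: circle_coord_def circle_point_def)

lemma circle_point_circle_coord:
  assumes "a \<in> sphere 0 1" "z \<in> sphere 0 1" "z \<noteq> a"
  shows "circle_point a (circle_coord a z) = z"
proof -
  have "a \<noteq> 0" using assms by auto
  then show ?thesis
    unfolding circle_point_def circle_coord_eq[OF assms, symmetric] by simp
qed

lemma continuous_on_circle_point: "continuous_on S (circle_point a)"
  unfolding circle_point_def using Complex_half_nonzero
  by (intro continuous_intros continuous_on_Complex) auto

lemma continuous_on_circle_coord: "continuous_on (- {a}) (circle_coord a)"
  unfolding circle_coord_def by (intro continuous_intros) auto

text \<open>
  Points near \<open>a\<close> correspond to large coordinates because the modulus of \<open>a / (z - a)\<close> is
  \<open>1 / norm (z - a)\<close>.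
\<close>

lemma circle_coord_large:
  assumes "a \<in> sphere 0 1" "z \<in> sphere 0 1" "z \<noteq> a" "norm (z - a) < 1 / (1 + \<bar>M\<bar>)"
  shows "\<bar>circle_coord a z\<bar> > M"
proof -
  have "norm (z - a) > 0" "1 + \<bar>M\<bar> > 0"
    using assms by auto
  then have "1 + \<bar>M\<bar> < norm (a / (z - a))"
    using assms(1,4) by (simp add: norm_divide field_simps)
  also have "\<dots> = norm (Complex (- 1 / 2) (circle_coord a z))"
    using circle_coord_eq[OF assms(1-3)] by simp
  also have "\<dots> \<le> 1 / 2 + \<bar>circle_coord a z\<bar>"
    using cmod_le[of "Complex (- 1 / 2) (circle_coord a z)"] by simp
  finally show ?thesis
    by linarith
qed

text \<open>
  The interval from \<open>u0\<close> to \<open>H u0\<close> is a fundamental domain for the iterates of \<open>H\<close> on the half-line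
  from \<open>u0\<close> on: stepping back by the inverse of \<open>H\<close> loses at least \<open>c\<close> each time.
\<close>

lemma affine_iterates_cover:
  fixes H :: "real \<Rightarrow> real"
  assumes H: "\<And>u. H u = \<alpha> * u + \<mu>" "\<alpha> > 0"
    and step: "\<And>u. u \<ge> u0 \<Longrightarrow> H u \<ge> u + c" "c > 0"
    and "u \<ge> u0"
  shows "\<exists>n v. u0 \<le> v \<and> v \<le> H u0 \<and> (H ^^ n) v = u"
proof -
  have "\<exists>n v. u0 \<le> v \<and> v \<le> H u0 \<and> (H ^^ n) v = u" if "u0 \<le> u" "u \<le> u0 + real m * c" for m u
    using that
  proof (induction m arbitrary: u)
    case 0
    then show ?case
      using step(1)[of u0] step(2) by (intro exI[of _ 0] exI[of _ u]) auto
  next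
    case (Suc m)
    show ?case
    proof (cases "u \<le> H u0")
      case True
      then show ?thesis
        using Suc.prems by (intro exI[of _ 0] exI[of _ u]) auto
    next
      case False
      define v where "v = (u - \<mu>) / \<alpha>"
      have Hv: "H v = u"
        using H by (simp add: v_def)
      then have "\<alpha> * v > \<alpha> * u0"
        using False H(1)[of v] H(1)[of u0] by linarith
      then have "v \<ge> u0"
        using H(2) by simp
      moreover have "v \<le> u0 + real m * c"
        using step(1)[OF \<open>v \<ge> u0\<close>] Hv Suc.prems(2) by (simp add: algebra_simps)
      ultimately obtain n v' where "u0 \<le> v'" "v' \<le> H u0" "(H ^^ n) v' = v"
        using Suc.IH by blast
      then show ?thesis
        using Hv by (intro exI[of _ "Suc n"] exI[of _ v']) auto
    qed
  qed
  moreover obtain m where "u - u0 \<le> real m * c"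
    using reals_Archimedean3[OF step(2)] less_imp_le by blast
  ultimately show ?thesis
    using assms(5) by (metis add.commute diff_le_eq)
qed

context fuchsian
begin

text \<open>
  A Moebius map fixing \<open>a\<close> fixes infinity in the coordinate at \<open>a\<close> and is therefore affine there. It
  is not the identity if it moves the centre.
\<close>

lemma circle_coord_affine:
  assumes h: "h \<in> \<Gamma>" and a: "a \<in> sphere 0 1" "h a = a"
  obtains \<alpha> \<mu> where "\<alpha> > 0" "h 0 \<noteq> 0 \<Longrightarrow> \<alpha> = 1 \<Longrightarrow> \<mu> \<noteq> 0"
    "\<And>z. z \<in> sphere 0 1 \<Longrightarrow> z \<noteq> a \<Longrightarrow> h z \<in> sphere 0 1 \<and> h z \<noteq> a \<and>
       circle_coord a (h z) = \<alpha> * circle_coord a z + \<mu>"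
proof -
  define w where "w = inverse_map h 0"
  obtain e where e: "norm e = 1" "norm w < 1"
    "\<And>z. z \<in> cball 0 1 \<Longrightarrow> h z = e * (z - w) / (1 - cnj w * z)"
    using moebius_form[OF h] unfolding w_def by metis
  have wz: "h 0 \<noteq> 0 \<Longrightarrow> w \<noteq> 0"
    using norm_inverse_map_0[OF h] by (auto simp: w_def)
  have a0: "a \<noteq> 0" "a \<noteq> w" "a * cnj a = 1"
    using a(1) e(2) by (auto simp: complex_norm_square[symmetric])
  define N where "N = 1 - (norm w)\<^sup>2"
  have N: "N > 0" "complex_of_real N = 1 - w * cnj w"
    using e(2) by (simp add: N_def abs_square_less_1)
      (simp only: N_def of_real_diff of_real_1 complex_norm_square)
  define \<alpha> where "\<alpha> = (norm (a - w))\<^sup>2 / N"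
  define \<beta> where "\<beta> = - (cnj w * (a - w)) / of_real N"
  have na: "1 - cnj w * a = a * cnj (a - w)"
    using a0 by (simp add: algebra_simps)
  have \<alpha>: "complex_of_real \<alpha> = (a - w) * cnj (a - w) / of_real N"
    by (simp only: \<alpha>_def of_real_divide complex_norm_square)
  have key: "h z \<in> sphere 0 1 \<and> h z \<noteq> a \<and> a / (h z - a) = of_real \<alpha> * (a / (z - a)) + \<beta>"
    if z: "z \<in> sphere 0 1" "z \<noteq> a" for z
  proof -
    have s: "h z \<in> sphere 0 1"
      by (rule maps_circle[OF h z(1)])
    have ne: "h z \<noteq> a"
      using inverse_map_left[OF h, of z] inverse_map_left[OF h, of a] z a by auto
    have nz: "1 - cnj w * z \<noteq> 0" "1 - cnj w * a \<noteq> 0"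
      using one_minus_cnj_mult_nonzero[OF e(2)] z a by auto
    have 1: "h z * (1 - cnj w * z) = e * (z - w)"
      using e(3)[of z] z nz by simp
    have 2: "a * (1 - cnj w * a) = e * (a - w)"
    proof -
      have "h a * (1 - cnj w * a) = e * (a - w)"
        using e(3)[of a] a(1) nz by simp
      then show ?thesis
        by (simp only: a(2))
    qed
    have 3: "(h z - a) * (1 - cnj w * z) * (1 - cnj w * a) = e * (z - a) * of_real N"
      unfolding N(2) using 1 2 by algebra
    have e0: "e \<noteq> 0" using e(1) by auto
    have 4: "(h z - a) * (1 - cnj w * z) * (a - w) = a * (z - a) * of_real N"
    proof -
      have "(h z - a) * (1 - cnj w * z) * (a - w) * e = a * (z - a) * of_real N * e"
        using 2 3 by algebra
      then show ?thesis using e0 by simp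
    qed
    have "a / (h z - a) = (1 - cnj w * z) * (a - w) / ((z - a) * of_real N)"
      using 4 ne z N(1) by (simp add: frac_eq_eq algebra_simps)
    also have "1 - cnj w * z = a * cnj (a - w) - cnj w * (z - a)"
      using na by (simp add: algebra_simps)
    also have "(a * cnj (a - w) - cnj w * (z - a)) * (a - w) / ((z - a) * of_real N)
        = of_real \<alpha> * (a / (z - a)) + \<beta>"
    proof -
      have "z - a \<noteq> 0" "complex_of_real N \<noteq> 0" using z N(1) by auto
      then show ?thesis
        unfolding \<alpha> \<beta>_def by (simp add: divide_simps del: complex_cnj_diff) (simp add: algebra_simps)
    qed
    finally show ?thesis using s ne by blast
  qed
  show ?thesis
  proof
    show "\<alpha> > 0"
      using N(1) a0 by (simp add: \<alpha>_def)
    show "h z \<in> sphere 0 1 \<and> h z \<noteq> a \<and> circle_coord a (h z) = \<alpha> * circle_coord a z + Im \<beta>"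
      if "z \<in> sphere 0 1" "z \<noteq> a" for z
      using key[OF that] by (simp add: circle_coord_def del: times_divide_eq_right)
    show "Im \<beta> \<noteq> 0" if "h 0 \<noteq> 0" "\<alpha> = 1"
    proof
      assume "Im \<beta> = 0"
      define z where "z = circle_point a 0"
      have z: "z \<in> sphere 0 1" "z \<noteq> a"
        using circle_point_in_circle[OF a(1)] by (auto simp: z_def)
      have "Re \<beta> = 0"
        using key[OF z] circle_coord_eq[OF a(1), of z] circle_coord_eq[OF a(1), of "h z"] z that(2)
        by (auto simp: complex_eq_iff)
      then have "\<beta> = 0"
        using \<open>Im \<beta> = 0\<close> by (simp add: complex_eq_iff)
      then show False
        using wz[OF that(1)] a0(2) N(1) by (simp add: \<beta>_def)
    qed
  qed
qed

text \<open>
  The sign \<open>s\<close> selects one of the two sides of \<open>a\<close>. On it either \<open>h\<close> or its inverse moves points near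
  \<open>a\<close> towards \<open>a\<close>, whether \<open>h\<close> is hyperbolic (slope different from 1) or parabolic (a translation).
\<close>

lemma expanding_affine:
  assumes h: "h \<in> \<Gamma>" and a: "a \<in> sphere 0 1" "h a = a" "h 0 \<noteq> 0"
    and s: "s = 1 \<or> s = - 1"
  obtains k \<alpha> \<mu> where "k \<in> \<Gamma>" "\<alpha> > 1 \<or> \<alpha> = 1 \<and> \<mu> > 0"
    "\<And>z. z \<in> sphere 0 1 \<Longrightarrow> z \<noteq> a \<Longrightarrow> k z \<in> sphere 0 1 \<and> k z \<noteq> a \<and>
       s * circle_coord a (k z) = \<alpha> * (s * circle_coord a z) + \<mu>"
proof -
  obtain \<alpha> \<mu> where am: "\<alpha> > 0" "\<alpha> = 1 \<Longrightarrow> \<mu> \<noteq> 0"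
    "\<And>z. z \<in> sphere 0 1 \<Longrightarrow> z \<noteq> a \<Longrightarrow> h z \<in> sphere 0 1 \<and> h z \<noteq> a \<and>
       circle_coord a (h z) = \<alpha> * circle_coord a z + \<mu>"
    using circle_coord_affine[OF h a(1,2)] a(3) by metis
  show ?thesis
  proof (cases "\<alpha> > 1 \<or> \<alpha> = 1 \<and> s * \<mu> > 0")
    case True
    then show ?thesis
      using am(3) h by (intro that[of h \<alpha> "s * \<mu>"]) (auto simp: algebra_simps)
  next
    case False
    let ?k = "inverse_map h"
    have k: "?k \<in> \<Gamma>" by (rule inverse_map_mem[OF h])
    have "1 / \<alpha> > 1 \<or> 1 / \<alpha> = 1 \<and> - (s * \<mu>) / \<alpha> > 0"
      using False am(1,2) s by (cases "\<alpha> = 1") (auto simp: not_less)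
    then show ?thesis
    proof (rule that[OF k])
      fix z :: complex assume z: "z \<in> sphere 0 1" "z \<noteq> a"
      have 1: "?k z \<in> sphere 0 1" by (rule maps_circle[OF k z(1)])
      have hk: "h (?k z) = z"
        using inverse_map_right[OF h] z by simp
      then have 2: "?k z \<noteq> a" using a z by auto
      have "circle_coord a z = \<alpha> * circle_coord a (?k z) + \<mu>"
        using am(3)[OF 1 2] hk by simp
      then have "s * circle_coord a (?k z) = 1 / \<alpha> * (s * circle_coord a z) + - (s * \<mu>) / \<alpha>"
        using am(1) by (simp add: field_simps)
      then show "?k z \<in> sphere 0 1 \<and> ?k z \<noteq> a \<and>
          s * circle_coord a (?k z) = 1 / \<alpha> * (s * circle_coord a z) + - (s * \<mu>) / \<alpha>"
        using 1 2 by blast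
    qed
  qed
qed

end

section \<open>End points at which concentration is obstructed\<close>

text \<open>
  A one-sided punctured neighbourhood of \<open>a\<close> in the circle; the sign \<open>s\<close> names the side.
\<close>

definition end_arc :: "complex \<Rightarrow> real \<Rightarrow> real \<Rightarrow> complex set" where
  "end_arc a s T = {z \<in> sphere 0 1 - {a}. s * circle_coord a z > T}"

lemma circle_point_image:
  assumes "a \<in> sphere 0 1" "s = 1 \<or> s = - 1"
  shows "{z \<in> sphere 0 1 - {a}. s * circle_coord a z \<in> I} = (\<lambda>t. circle_point a (s * t)) ` I"
proof (intro equalityI subsetI)
  fix z assume z: "z \<in> {z \<in> sphere 0 1 - {a}. s * circle_coord a z \<in> I}"
  then have "circle_point a (s * (s * circle_coord a z)) = z"
    using circle_point_circle_coord[OF assms(1), of z] assms(2) by auto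
  then show "z \<in> (\<lambda>t. circle_point a (s * t)) ` I"
    using z by (metis (no_types, lifting) image_eqI mem_Collect_eq)
next
  fix z assume "z \<in> (\<lambda>t. circle_point a (s * t)) ` I"
  then show "z \<in> {z \<in> sphere 0 1 - {a}. s * circle_coord a z \<in> I}"
    using circle_point_in_circle[OF assms(1)] circle_coord_circle_point[OF assms(1)] assms(2) by auto
qed

lemma openin_circle_coord:
  assumes "open I"
  shows "openin (top_of_set (sphere 0 1)) {z \<in> sphere 0 1 - {a}. s * circle_coord a z \<in> I}"
proof -
  have "open ((\<lambda>z. s * circle_coord a z) -` I \<inter> - {a})"
    using assms continuous_on_open_vimage[of "- {a}" "\<lambda>z. s * circle_coord a z"]
      continuous_on_mult_left[OF continuous_on_circle_coord] by blast
  moreover have "{z \<in> sphere 0 1 - {a}. s * circle_coord a z \<in> I}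
      = sphere 0 1 \<inter> ((\<lambda>z. s * circle_coord a z) -` I \<inter> - {a})"
    by auto
  ultimately show ?thesis
    by (metis openin_open)
qed

lemma openin_end_arc: "openin (top_of_set (sphere 0 1)) (end_arc a s T)"
  using openin_circle_coord[of "{T<..}" a s] by (simp add: end_arc_def)

lemma connected_end_arc:
  assumes "a \<in> sphere 0 1" "s = 1 \<or> s = - 1"
  shows "connected (end_arc a s T)"
proof -
  have "end_arc a s T = (\<lambda>t. circle_point a (s * t)) ` {T<..}"
    using circle_point_image[OF assms, of "{T<..}"] by (simp add: end_arc_def)
  moreover have "continuous_on {T<..} (\<lambda>t. circle_point a (s * t))"
    by (rule continuous_on_compose2[OF continuous_on_circle_point[of UNIV]]) (auto intro: continuous_intros)
  ultimately show ?thesis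
    by (simp add: connected_continuous_image)
qed

context fuchsian
begin

text \<open>
  If \<open>g\<close> squeezes \<open>X\<close> near \<open>p\<close> and the pullback \<open>y\<close> of \<open>p\<close> lies close to \<open>a\<close>, then \<open>y = f y'\<close> for
  some power \<open>f\<close> of a map that fixes \<open>a\<close> and pushes the arc towards \<open>a\<close>, with \<open>y'\<close> in a fixed
  compact fundamental domain \<open>D\<close>. Since \<open>f\<close> maps a fixed end arc \<open>A\<close> inside \<open>X\<close> into itself, \<open>g\<close>
  after \<open>f\<close> still squeezes \<open>A\<close> near \<open>p\<close>, while now pulling \<open>p\<close> back into \<open>D\<close>. This is excluded by
  \<open>concentration_avoids_compact\<close>.
\<close>

lemma concentration_avoids_end_arc:
  assumes p: "nonconical_at p" "p \<in> sphere 0 1"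
    and h: "h \<in> \<Gamma>" and a: "a \<in> sphere 0 1" "h a = a" "h 0 \<noteq> 0"
    and s: "s = 1 \<or> s = - 1" and X: "end_arc a s T \<subseteq> X"
  obtains T' \<epsilon> where "\<epsilon> > 0"
    "\<And>g. g \<in> \<Gamma> \<Longrightarrow> g ` X \<subseteq> ball p \<epsilon> \<Longrightarrow> inverse_map g p \<notin> end_arc a s T'"
proof -
  obtain k \<alpha> \<mu> where k: "k \<in> \<Gamma>" "\<alpha> > 1 \<or> \<alpha> = 1 \<and> \<mu> > 0"
    "\<And>z. z \<in> sphere 0 1 \<Longrightarrow> z \<noteq> a \<Longrightarrow> k z \<in> sphere 0 1 \<and> k z \<noteq> a \<and>
       s * circle_coord a (k z) = \<alpha> * (s * circle_coord a z) + \<mu>"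
    using expanding_affine[OF h a s] by metis
  define H where "H u = \<alpha> * u + \<mu>" for u
  obtain u1 c where c: "c > 0" "\<And>u. u \<ge> u1 \<Longrightarrow> H u \<ge> u + c"
  proof (cases "\<alpha> > 1")
    case True
    have "H u \<ge> u + 1" if "u \<ge> (1 - \<mu>) / (\<alpha> - 1)" for u
      using that True by (simp add: H_def field_simps)
    then show ?thesis
      using that[of 1] by (metis zero_less_one)
  next
    case False
    then show ?thesis
      using k(2) that[of \<mu> 0] by (auto simp: H_def)
  qed
  define T1 where "T1 = max T u1"
  let ?u0 = "T1 + 1"
  define A where "A = end_arc a s T1"
  define D where "D = {z \<in> sphere 0 1 - {a}. s * circle_coord a z \<in> {?u0..H ?u0}}"
  have "compact D"
    unfolding D_def circle_point_image[OF a(1) s]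
    by (intro compact_continuous_image continuous_on_compose2[OF continuous_on_circle_point[of UNIV]])
      (auto intro: continuous_intros)
  moreover have "D \<subseteq> A"
    by (auto simp: D_def A_def end_arc_def)
  ultimately obtain \<epsilon> where \<epsilon>: "\<epsilon> > 0"
    "\<And>g. g \<in> \<Gamma> \<Longrightarrow> g ` A \<subseteq> ball p \<epsilon> \<Longrightarrow> inverse_map g p \<notin> D"
    using concentration_avoids_compact[OF p openin_end_arc[of a s T1]] unfolding A_def by metis
  have iterate: "\<exists>f\<in>\<Gamma>. \<forall>z\<in>sphere 0 1 - {a}. f z \<in> sphere 0 1 - {a} \<and>
      s * circle_coord a (f z) = (H ^^ n) (s * circle_coord a z)" for n
  proof (induction n)
    case 0
    show ?case
      by (rule bexI[OF _ identity_mem]) auto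
  next
    case (Suc n)
    then obtain f where f: "f \<in> \<Gamma>" "\<forall>z\<in>sphere 0 1 - {a}. f z \<in> sphere 0 1 - {a} \<and>
      s * circle_coord a (f z) = (H ^^ n) (s * circle_coord a z)"
      by blast
    have "compose (cball 0 1) k f \<in> \<Gamma>"
      by (rule compose_mem[OF k(1) f(1)])
    moreover have "\<forall>z\<in>sphere 0 1 - {a}. compose (cball 0 1) k f z \<in> sphere 0 1 - {a} \<and>
      s * circle_coord a (compose (cball 0 1) k f z) = (H ^^ Suc n) (s * circle_coord a z)"
    proof
      fix z assume z: "z \<in> sphere 0 1 - {a}"
      then have "compose (cball 0 1) k f z = k (f z)"
        by (simp add: compose_def)
      then show "compose (cball 0 1) k f z \<in> sphere 0 1 - {a} \<and>
        s * circle_coord a (compose (cball 0 1) k f z) = (H ^^ Suc n) (s * circle_coord a z)"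
        using f(2) z k(3)[of "f z"] by (auto simp: H_def)
    qed
    ultimately show ?case by blast
  qed
  show ?thesis
  proof (rule that[OF \<epsilon>(1)])
    fix g assume g: "g \<in> \<Gamma>" "g ` X \<subseteq> ball p \<epsilon>"
    define y where "y = inverse_map g p"
    show "inverse_map g p \<notin> end_arc a s ?u0"
    proof
      assume "inverse_map g p \<in> end_arc a s ?u0"
      then have y: "y \<in> sphere 0 1 - {a}" "s * circle_coord a y \<ge> ?u0"
        by (auto simp: y_def end_arc_def)
      have stepu: "\<And>u. u \<ge> ?u0 \<Longrightarrow> H u \<ge> u + c"
        by (rule c(2)) (simp add: T1_def)
      obtain n v where v: "?u0 \<le> v" "v \<le> H ?u0" "(H ^^ n) v = s * circle_coord a y"
        using affine_iterates_cover[of H \<alpha> \<mu> ?u0 c "s * circle_coord a y"] H_def k(2) stepu c(1) y(2)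
        by fastforce
      obtain f where f: "f \<in> \<Gamma>" "\<forall>z\<in>sphere 0 1 - {a}. f z \<in> sphere 0 1 - {a} \<and>
        s * circle_coord a (f z) = (H ^^ n) (s * circle_coord a z)"
        using iterate by blast
      define y' where "y' = circle_point a (s * v)"
      have y': "y' \<in> sphere 0 1 - {a}" "s * circle_coord a y' = v"
        using circle_point_in_circle[OF a(1)] circle_coord_circle_point[OF a(1)] s
        by (auto simp: y'_def)
      have "s * circle_coord a (f y') = s * circle_coord a y" "f y' \<in> sphere 0 1 - {a}"
        using f(2) y' v(3) by auto
      then have "circle_coord a (f y') = circle_coord a y" "f y' \<in> sphere 0 1" "f y' \<noteq> a"
        using s by auto
      then have fy: "f y' = y"
        using circle_point_circle_coord[OF a(1)] y(1) by (metis DiffE insertI1)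
      have grow: "(H ^^ m) u > T1" if "u > T1" for m u
      proof (induction m)
        case (Suc m)
        then show ?case using c(2)[of "(H ^^ m) u"] c(1) by (simp add: T1_def)
      qed (use that in simp)
      have fA: "f ` A \<subseteq> A"
        using f(2) grow by (auto simp: A_def end_arc_def)
      define g' where "g' = compose (cball 0 1) g f"
      have g'\<Gamma>: "g' \<in> \<Gamma>"
        unfolding g'_def by (rule compose_mem[OF g(1) f(1)])
      have g'z: "g' z = g (f z)" if "z \<in> sphere 0 1" for z
        using that by (simp add: g'_def compose_def)
      have "A \<subseteq> X"
        using X by (auto simp: A_def end_arc_def T1_def)
      have "g' ` A \<subseteq> ball p \<epsilon>"
      proof (rule image_subsetI)
        fix z assume z: "z \<in> A"
        then have "f z \<in> X"
          using fA \<open>A \<subseteq> X\<close> by blast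
        then have "g (f z) \<in> ball p \<epsilon>"
          using g(2) by blast
        then show "g' z \<in> ball p \<epsilon>"
          using g'z[of z] z by (simp add: A_def end_arc_def)
      qed
      then have "inverse_map g' p \<notin> D"
        by (rule \<epsilon>(2)[OF g'\<Gamma>])
      moreover have "g' y' = p"
        using g'z y' fy inverse_map_right[OF g(1), of p] p(2) by (simp add: y_def)
      then have "inverse_map g' p = y'"
        using inverse_map_left[OF g'\<Gamma>, of y'] y' by simp
      moreover have "y' \<in> D"
        using y' v by (simp add: D_def)
      ultimately show False by simp
    qed
  qed
qed

text \<open>
  A short end arc is connected and misses the finitely many frontier points of \<open>X\<close>.
\<close>

lemma end_arc_inside_or_outside:
  assumes X: "openin (top_of_set (sphere 0 1)) X" and fin: "finite (closure X - X)"
    and a: "a \<in> sphere 0 1" and s: "s = 1 \<or> s = - 1"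
  obtains T where "end_arc a s T \<subseteq> X \<or> end_arc a s T \<inter> X = {}"
proof -
  define T where "T = Max (insert 0 ((\<lambda>b. s * circle_coord a b) ` (closure X - X)))"
  have "s * circle_coord a b \<le> T" if "b \<in> closure X - X" for b
    unfolding T_def using that fin by (intro Max_ge) auto
  then have disj: "end_arc a s T \<inter> (closure X - X) = {}"
    by (fastforce simp: end_arc_def)
  obtain G where G: "open G" "X = sphere 0 1 \<inter> G"
    using X by (auto simp: openin_open)
  have "openin (top_of_set (end_arc a s T)) (end_arc a s T \<inter> X)"
    using G by (auto simp: openin_open end_arc_def)
  moreover have "end_arc a s T \<inter> X = end_arc a s T \<inter> closure X"
    using disj closure_subset by blast
  then have "closedin (top_of_set (end_arc a s T)) (end_arc a s T \<inter> X)"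
    by (auto simp: closedin_closed)
  ultimately have "end_arc a s T \<inter> X = {} \<or> end_arc a s T \<inter> X = end_arc a s T"
    using connected_end_arc[OF a s, of T] unfolding connected_clopen by blast
  then show ?thesis
    using that by blast
qed

text \<open>
  The end points from which concentration of an arc can be excluded. Requiring \<open>h 0 \<noteq> 0\<close> rather than
  that \<open>h\<close> is not the identity is no loss, because a rotation about the centre has no fixed point on
  the circle unless it is trivial.
\<close>

definition flexible_point :: "complex \<Rightarrow> bool" where
  "flexible_point a \<longleftrightarrow> a \<in> sphere 0 1 \<and>
     (\<not> limit_point \<Gamma> a \<or> (\<exists>h\<in>\<Gamma>. h a = a \<and> h 0 \<noteq> 0))"

lemma concentration_avoids_flexible_point:
  assumes p: "nonconical_at p" "p \<in> sphere 0 1"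
    and X: "openin (top_of_set (sphere 0 1)) X" "X \<noteq> {}" "finite (closure X - X)"
    and a: "a \<in> closure X - X" "flexible_point a"
  obtains r \<epsilon> where "r > 0" "\<epsilon> > 0"
    "\<And>g. g \<in> \<Gamma> \<Longrightarrow> g ` X \<subseteq> ball p \<epsilon> \<Longrightarrow> inverse_map g p \<in> X \<Longrightarrow> inverse_map g p \<notin> ball a r"
proof (cases "limit_point \<Gamma> a")
  case False
  then show ?thesis
    using concentration_avoids_nonlimit_point[OF p(1) X(1,2)] a(2) that
    unfolding flexible_point_def by metis
next
  case True
  then obtain h where h: "h \<in> \<Gamma>" "a \<in> sphere 0 1" "h a = a" "h 0 \<noteq> 0"
    using a(2) unfolding flexible_point_def by blast
  have side: "\<exists>T \<epsilon>. \<epsilon> > 0 \<and> (\<forall>g\<in>\<Gamma>. g ` X \<subseteq> ball p \<epsilon> \<longrightarrow> inverse_map g p \<in> X \<longrightarrow>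
      inverse_map g p \<notin> end_arc a s T)" if s: "s = 1 \<or> s = - 1" for s
  proof -
    obtain T where T: "end_arc a s T \<subseteq> X \<or> end_arc a s T \<inter> X = {}"
      using end_arc_inside_or_outside[OF X(1,3) h(2) s] by blast
    show ?thesis
    proof (cases "end_arc a s T \<subseteq> X")
      case True
      then show ?thesis
        using concentration_avoids_end_arc[OF p h s True] by metis
    next
      case False
      then show ?thesis
        using T by (intro exI[of _ T] exI[of _ 1]) auto
    qed
  qed
  obtain T1 \<epsilon>1 where 1: "\<epsilon>1 > 0" "\<And>g. g \<in> \<Gamma> \<Longrightarrow> g ` X \<subseteq> ball p \<epsilon>1 \<Longrightarrow> inverse_map g p \<in> X \<Longrightarrow>
      inverse_map g p \<notin> end_arc a 1 T1"
    using side[of 1] by auto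
  obtain T2 \<epsilon>2 where 2: "\<epsilon>2 > 0" "\<And>g. g \<in> \<Gamma> \<Longrightarrow> g ` X \<subseteq> ball p \<epsilon>2 \<Longrightarrow> inverse_map g p \<in> X \<Longrightarrow>
      inverse_map g p \<notin> end_arc a (- 1) T2"
    using side[of "- 1"] by auto
  define M where "M = max T1 T2"
  show ?thesis
  proof
    show "1 / (1 + \<bar>M\<bar>) > 0" "min \<epsilon>1 \<epsilon>2 > 0"
      using 1 2 by (auto simp: field_simps add_pos_nonneg)
    fix g assume g: "g \<in> \<Gamma>" "g ` X \<subseteq> ball p (min \<epsilon>1 \<epsilon>2)" "inverse_map g p \<in> X"
    define y where "y = inverse_map g p"
    have y: "y \<in> sphere 0 1" "y \<noteq> a"
      using maps_circle[OF inverse_map_mem[OF g(1)] p(2)] g(3) a(1) by (auto simp: y_def)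
    have "g ` X \<subseteq> ball p \<epsilon>1" "g ` X \<subseteq> ball p \<epsilon>2"
      using g(2) by auto
    then have "circle_coord a y \<le> T1" "- circle_coord a y \<le> T2"
      using 1(2)[OF g(1)] 2(2)[OF g(1)] g(3) y by (auto simp: end_arc_def y_def)
    then have "\<not> \<bar>circle_coord a y\<bar> > M"
      by (auto simp: M_def)
    then show "inverse_map g p \<notin> ball a (1 / (1 + \<bar>M\<bar>))"
      using circle_coord_large[OF h(2) y, of M] by (auto simp: y_def dist_norm norm_minus_commute)
  qed
qed

text \<open>
  The pullback of \<open>p\<close> by a concentrating element can come close to no frontier point, so it stays in
  a compact part of \<open>X\<close>, and this is impossible as well.
\<close>

lemma no_concentration_at_nonconical_point:
  assumes p: "nonconical_at p" "p \<in> sphere 0 1"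
    and X: "openin (top_of_set (sphere 0 1)) X" "finite (closure X - X)"
    and flex: "\<And>a. a \<in> closure X - X \<Longrightarrow> flexible_point a"
  shows "\<not> can_be_concentrated \<Gamma> X p"
proof
  assume conc: "can_be_concentrated \<Gamma> X p"
  have "circle_neighborhood (sphere 0 1) p"
    using p(2) by (simp add: circle_neighborhood_def)
  then have "X \<noteq> {}"
    using conc unfolding can_be_concentrated_def by blast
  have "\<exists>r \<epsilon>. r > 0 \<and> \<epsilon> > 0 \<and> (\<forall>g\<in>\<Gamma>. g ` X \<subseteq> ball p \<epsilon> \<longrightarrow> inverse_map g p \<in> X \<longrightarrow>
      inverse_map g p \<notin> ball a r)" if "a \<in> closure X - X" for a
    using concentration_avoids_flexible_point[OF p X(1) \<open>X \<noteq> {}\<close> X(2) that flex[OF that]] by metis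
  then obtain r \<epsilon> where r: "\<And>a. a \<in> closure X - X \<Longrightarrow> r a > (0::real) \<and> \<epsilon> a > (0::real) \<and>
      (\<forall>g\<in>\<Gamma>. g ` X \<subseteq> ball p (\<epsilon> a) \<longrightarrow> inverse_map g p \<in> X \<longrightarrow> inverse_map g p \<notin> ball a (r a))"
    by metis
  define D where "D = closure X - (\<Union>a\<in>closure X - X. ball a (r a))"
  have "X \<subseteq> sphere 0 1"
    using X(1) openin_imp_subset by blast
  then have "bounded X"
    using bounded_subset[OF bounded_sphere] by blast
  then have "compact D"
    unfolding D_def by (intro compact_diff) (auto simp: compact_closure)
  moreover have "D \<subseteq> X"
  proof
    fix z assume z: "z \<in> D"
    show "z \<in> X"
    proof (rule ccontr)
      assume "z \<notin> X"
      then have "z \<in> closure X - X"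
        using z by (simp add: D_def)
      moreover from this have "z \<in> ball z (r z)"
        using r by simp
      ultimately show False
        using z unfolding D_def by blast
    qed
  qed
  ultimately obtain \<epsilon>0 where \<epsilon>0: "\<epsilon>0 > 0"
    "\<And>g. g \<in> \<Gamma> \<Longrightarrow> g ` X \<subseteq> ball p \<epsilon>0 \<Longrightarrow> inverse_map g p \<notin> D"
    using concentration_avoids_compact[OF p X(1)] by metis
  define e where "e = Min (insert \<epsilon>0 (\<epsilon> ` (closure X - X)))"
  have e: "e > 0" "e \<le> \<epsilon>0" "\<And>a. a \<in> closure X - X \<Longrightarrow> e \<le> \<epsilon> a"
    using X(2) \<epsilon>0(1) r by (auto simp: e_def)
  have "circle_neighborhood (sphere 0 1 \<inter> ball p e) p"
    using p(2) e(1) by (auto simp: circle_neighborhood_def openin_open)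
  then obtain g where g: "g \<in> \<Gamma>" "p \<in> g ` X" "g ` X \<subseteq> sphere 0 1 \<inter> ball p e"
    using conc unfolding can_be_concentrated_def by blast
  then have y: "inverse_map g p \<in> X"
    using inverse_map_left[OF g(1)] \<open>X \<subseteq> sphere 0 1\<close> by force
  have "inverse_map g p \<notin> D"
    by (rule \<epsilon>0(2)[OF g(1)]) (use g(3) e(2) in force)
  then obtain a where a: "a \<in> closure X - X" "inverse_map g p \<in> ball a (r a)"
    using y closure_subset[of X] unfolding D_def by blast
  have "g ` X \<subseteq> ball p (\<epsilon> a)"
    using g(3) e(3)[OF a(1)] by force
  then show False
    using r[OF a(1)] g(1) y a(2) by blast
qed

end

section \<open>Flexible points are dense in the circle\<close>

context fuchsian
begin

lemma image_of_interior_point_near_center: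
  assumes "g \<in> \<Gamma>" "norm z < 1"
  shows "norm (g z - g 0) \<le> (1 - (norm (inverse_map g 0))\<^sup>2) / (1 - norm z)"
proof -
  define w where "w = inverse_map g 0"
  have w: "norm w < 1"
    unfolding w_def by (rule norm_zero_less_1[OF assms(1)])
  then have w2: "(norm w)\<^sup>2 \<le> 1"
    by (simp add: power_le_one)
  have "norm (cnj w * z) \<le> 1 * norm z"
    unfolding norm_mult using w by (intro mult_right_mono) auto
  then have "1 - norm z \<le> norm (1 - cnj w * z)"
    using norm_triangle_ineq2[of 1 "cnj w * z"] by simp
  then have "norm (g z - g 0) * (1 - norm z) \<le> norm (g z - g 0) * norm (1 - cnj w * z)"
    by (intro mult_left_mono) auto
  also have "\<dots> = norm z * (1 - (norm w)\<^sup>2)"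
    using dist_images[OF assms(1), of z 0] assms(2) by (simp add: w_def)
  also have "\<dots> \<le> 1 * (1 - (norm w)\<^sup>2)"
    using assms(2) w2 by (intro mult_right_mono) auto
  finally show ?thesis
    using assms(2) by (simp add: w_def le_divide_eq)
qed

text \<open>
  The limit set does not depend on the base point of the orbit: near the circle, the images of two
  fixed interior points are close. The constant \<open>c\<close> absorbs the dependence on \<open>z\<close>.
\<close>

lemma orbit_of_0_near_limit_point:
  assumes "limit_point \<Gamma> x" "\<epsilon> > 0"
  obtains g where "g \<in> \<Gamma>" "norm (g 0 - x) < \<epsilon>"
proof -
  have x: "norm x = 1"
    using assms(1) by (simp add: limit_point_def)
  obtain z where z: "norm z < 1" "x islimpt ((\<lambda>g. g z) ` \<Gamma>)"
    using assms(1) by (auto simp: limit_point_def)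
  define R where "R = 1 - (norm z)\<^sup>2"
  define m where "m = 1 - norm z"
  have R: "R > 0" "m > 0"
    using z(1) by (simp_all add: R_def m_def abs_square_less_1)
  define c where "c = 1 + 8 / (R * m)"
  have c: "c > 0"
    using R by (simp add: c_def add_pos_pos)
  have "\<exists>y\<in>(\<lambda>g. g z) ` \<Gamma>. y \<noteq> x \<and> dist y x < \<epsilon> / c"
    using z(2) assms(2) c by (simp add: islimpt_approachable)
  then obtain g where g: "g \<in> \<Gamma>" "norm (g z - x) < \<epsilon> / c"
    by (auto simp: dist_norm)
  define w where "w = inverse_map g 0"
  define \<eta> where "\<eta> = norm (g z - x)"
  have w: "norm w < 1"
    unfolding w_def by (rule norm_zero_less_1[OF g(1)])
  have gz: "norm (g z) \<le> 1"
    using maps_closed_disc[OF g(1), of z] z(1) by simp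
  have "1 - norm (g z) \<le> \<eta>"
    using norm_triangle_ineq2[of x "g z"] x by (simp add: \<eta>_def norm_minus_commute)
  then have 1: "1 - (norm (g z))\<^sup>2 \<le> 2 * \<eta>"
    by (rule one_minus_square_le)
  have "norm (1 - cnj w * z) \<le> 1 + norm w * norm z"
    using norm_triangle_ineq4[of 1 "cnj w * z"] by (simp add: norm_mult)
  also have "\<dots> \<le> 1 + 1 * 1"
    using w z(1) by (intro add_left_mono mult_mono) auto
  finally have 2: "(norm (1 - cnj w * z))\<^sup>2 \<le> 2\<^sup>2"
    by (intro power_mono) auto
  have "R * (1 - (norm w)\<^sup>2) = (1 - (norm (g z))\<^sup>2) * (norm (1 - cnj w * z))\<^sup>2"
    using one_minus_norm_image[OF g(1), of z] z(1) by (simp add: R_def w_def)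
  also have "\<dots> \<le> 2 * \<eta> * 2\<^sup>2"
    using 1 2 by (intro mult_mono) (auto simp: \<eta>_def)
  finally have "1 - (norm w)\<^sup>2 \<le> 8 * \<eta> / R"
    using R by (simp add: field_simps)
  then have "(1 - (norm w)\<^sup>2) / m \<le> 8 * \<eta> / R / m"
    using R by (intro divide_right_mono) auto
  then have "norm (g z - g 0) \<le> 8 * \<eta> / R / m"
    using image_of_interior_point_near_center[OF g(1) z(1)] by (simp add: w_def m_def)
  moreover have "norm (g 0 - x) \<le> norm (g z - g 0) + norm (g z - x)"
    by (rule norm_diff_triangle_le[OF _ order_refl]) (simp add: norm_minus_commute)
  ultimately have "norm (g 0 - x) \<le> \<eta> * c"
    by (simp add: \<eta>_def c_def algebra_simps)
  also have "\<dots> < \<epsilon>"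
    using g(2) c by (simp add: \<eta>_def field_simps)
  finally show ?thesis
    using that g(1) by blast
qed

lemma one_minus_norm_zero_le:
  assumes "g \<in> \<Gamma>" "norm x = 1"
  shows "1 - (norm (inverse_map g 0))\<^sup>2 \<le> 2 * norm (g 0 - x)"
proof -
  have "1 - norm (g 0) \<le> norm (g 0 - x)"
    using norm_triangle_ineq2[of x "g 0"] assms(2) by (simp add: norm_minus_commute)
  then show ?thesis
    unfolding norm_inverse_map_0[OF assms(1)] by (rule one_minus_square_le)
qed

text \<open>
  Elements \<open>g\<close> with \<open>g 0\<close> near \<open>x\<close> may have their zero near \<open>x\<close> too. Precomposing with \<open>g1\<close> moves
  that zero by the inverse of \<open>g1\<close>, hence away from \<open>x\<close>, and hardly changes the image of the centre.
\<close>

lemma attracting_with_distant_repeller: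
  assumes lim: "limit_point \<Gamma> x" and g1: "g1 \<in> \<Gamma>" "g1 x \<noteq> x"
  obtains \<delta> where "\<delta> > 0"
    "\<And>\<epsilon>. \<epsilon> > 0 \<Longrightarrow> \<exists>g\<in>\<Gamma>. norm (g 0 - x) < \<epsilon> \<and> norm (inverse_map g 0 - x) \<ge> \<delta>"
proof -
  have x: "norm x = 1"
    using lim by (simp add: limit_point_def)
  define g2 where "g2 = inverse_map g1"
  have g2: "g2 \<in> \<Gamma>"
    unfolding g2_def by (rule inverse_map_mem[OF g1(1)])
  have g2x: "g2 x \<noteq> x"
    using inverse_map_right[OF g1(1), of x] g1(2) x by (auto simp: g2_def)
  define \<eta> where "\<eta> = norm (g2 x - x) / 2"
  define w2 where "w2 = inverse_map g2 0"
  have w2: "norm w2 < 1"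
    unfolding w2_def by (rule norm_zero_less_1[OF g2])
  have "\<eta> > 0"
    using g2x by (simp add: \<eta>_def)
  \<comment> \<open>A Lipschitz constant of \<open>g2\<close> on the closed disc is \<open>1 / (1 - norm w2)\<^sup>2\<close>.\<close>
  define d where "d = \<eta> * (1 - norm w2)\<^sup>2"
  have d: "d > 0"
    using \<open>\<eta> > 0\<close> w2 by (simp add: d_def)
  have cont: "norm (g2 u - x) \<ge> \<eta>" if u: "norm u \<le> 1" "norm (u - x) < d" for u
  proof -
    have low: "1 - norm w2 \<le> norm (1 - cnj w2 * z)" if "norm z \<le> 1" for z
    proof -
      have "norm (cnj w2 * z) \<le> norm w2 * 1"
        unfolding norm_mult using that by (intro mult_mono) auto
      then show ?thesis
        using norm_triangle_ineq2[of 1 "cnj w2 * z"] by simp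
    qed
    have "norm (g2 u - g2 x) * (1 - norm w2)\<^sup>2
        \<le> norm (g2 u - g2 x) * (norm (1 - cnj w2 * u) * norm (1 - cnj w2 * x))"
      unfolding power2_eq_square using low[of u] low[of x] u(1) x w2
      by (intro mult_left_mono mult_mono) auto
    also have "\<dots> = norm (u - x) * (1 - (norm w2)\<^sup>2)"
      using dist_images[OF g2, of u x] u(1) x by (simp add: w2_def mult.assoc)
    also have "\<dots> \<le> norm (u - x) * 1"
      by (intro mult_left_mono) auto
    also have "\<dots> < \<eta> * (1 - norm w2)\<^sup>2"
      using u(2) by (simp add: d_def)
    finally have "norm (g2 u - g2 x) < \<eta>"
      using w2 by (simp add: mult_less_cancel_right)
    moreover have "norm (g2 x - x) \<le> norm (g2 u - g2 x) + norm (g2 u - x)"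
      by (rule norm_diff_triangle_le[OF _ order_refl]) (simp add: norm_minus_commute)
    ultimately show ?thesis
      by (simp add: \<eta>_def)
  qed
  show ?thesis
  proof
    show "min d \<eta> > 0"
      using d \<open>\<eta> > 0\<close> by simp
    fix \<epsilon> :: real assume \<epsilon>: "\<epsilon> > 0"
    define m where "m = 1 - norm (g1 0)"
    have g10: "norm (g1 0) < 1"
      using norm_inverse_map_0[OF g1(1)] norm_zero_less_1[OF g1(1)] by simp
    then have m: "m > 0" by (simp add: m_def)
    define c where "c = 1 + 2 / m"
    have c: "c \<ge> 1" using m by (simp add: c_def)
    then have "\<epsilon> / c > 0" "\<epsilon> / c \<le> \<epsilon>"
      using \<epsilon> by (auto simp: divide_le_eq)
    obtain g where g: "g \<in> \<Gamma>" "norm (g 0 - x) < \<epsilon> / c"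
      using orbit_of_0_near_limit_point[OF lim \<open>\<epsilon> / c > 0\<close>] by blast
    show "\<exists>g\<in>\<Gamma>. norm (g 0 - x) < \<epsilon> \<and> norm (inverse_map g 0 - x) \<ge> min d \<eta>"
    proof (cases "norm (inverse_map g 0 - x) \<ge> d")
      case True
      then show ?thesis
        using g \<open>\<epsilon> / c \<le> \<epsilon>\<close> by (intro bexI[of _ g]) auto
    next
      case False
      define k where "k = compose (cball 0 1) g g1"
      have k: "k \<in> \<Gamma>"
        unfolding k_def by (rule compose_mem[OF g(1) g1(1)])
      have k0: "k 0 = g (g1 0)"
        by (simp add: k_def compose_def)
      have w: "norm (inverse_map g 0) \<le> 1"
        using norm_zero_less_1[OF g(1)] by simp
      have "k (g2 (inverse_map g 0)) = 0"
      proof -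
        have "g2 (inverse_map g 0) \<in> cball 0 1"
          using maps_closed_disc[OF g2] w by simp
        then have "k (g2 (inverse_map g 0)) = g (g1 (g2 (inverse_map g 0)))"
          by (simp add: k_def compose_def)
        then show ?thesis
          using inverse_map_right[OF g1(1), of "inverse_map g 0"] inverse_map_right[OF g(1), of 0] w
          by (simp add: g2_def)
      qed
      then have wk: "inverse_map k 0 = g2 (inverse_map g 0)"
        using inverse_map_left[OF k, of "g2 (inverse_map g 0)"] maps_closed_disc[OF g2, of "inverse_map g 0"] w
        by simp
      have "norm (k 0 - g 0) \<le> (1 - (norm (inverse_map g 0))\<^sup>2) / m"
        unfolding k0 m_def by (rule image_of_interior_point_near_center[OF g(1) g10])
      also have "\<dots> \<le> 2 * norm (g 0 - x) / m"
        using one_minus_norm_zero_le[OF g(1) x] m by (intro divide_right_mono) auto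
      finally have "norm (k 0 - g 0) \<le> 2 * norm (g 0 - x) / m" .
      moreover have "norm (k 0 - x) \<le> norm (k 0 - g 0) + norm (g 0 - x)"
        by (rule norm_diff_triangle_le[OF order_refl order_refl])
      ultimately have "norm (k 0 - x) \<le> norm (g 0 - x) * c"
        by (simp add: c_def algebra_simps)
      also have "\<dots> < \<epsilon>"
        using g(2) c by (simp add: field_simps)
      finally have "norm (k 0 - x) < \<epsilon>" .
      moreover have "norm (inverse_map k 0 - x) \<ge> \<eta>"
        unfolding wk by (rule cont[OF w]) (use False in simp)
      ultimately show ?thesis
        using k by (intro bexI[of _ k]) auto
    qed
  qed
qed

text \<open>
  An element sending the centre close to \<open>x\<close> whose zero is at a definite distance from \<open>x\<close> maps a
  small arc around \<open>x\<close> into itself and contracts it, so it has a fixed point there.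
\<close>

lemma fixed_point_near_limit_point:
  assumes lim: "limit_point \<Gamma> x" and g1: "g1 \<in> \<Gamma>" "g1 x \<noteq> x" and "\<rho> > 0"
  obtains a h where "a \<in> sphere 0 1" "norm (a - x) \<le> \<rho>" "h \<in> \<Gamma>" "h a = a" "h 0 \<noteq> 0"
proof -
  have x: "norm x = 1"
    using lim by (simp add: limit_point_def)
  obtain \<delta> where \<delta>: "\<delta> > 0"
    "\<And>\<epsilon>. \<epsilon> > 0 \<Longrightarrow> \<exists>g\<in>\<Gamma>. norm (g 0 - x) < \<epsilon> \<and> norm (inverse_map g 0 - x) \<ge> \<delta>"
    using attracting_with_distant_repeller[OF lim g1] by blast
  define r where "r = min \<rho> (\<delta> / 2)"
  \<comment> \<open>The three bounds ensure \<open>g 0 \<noteq> 0\<close>, the contraction factor \<open>1 / 2\<close>, and invariance of the arc.\<close>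
  define \<epsilon> where "\<epsilon> = min (1 / 2) (min (\<delta>\<^sup>2 / 16) (r / (1 + 4 / \<delta>)))"
  have r: "r > 0" "r \<le> \<rho>" "r \<le> \<delta> / 2"
    using \<delta>(1) assms(4) by (auto simp: r_def)
  have pos: "1 + 4 / \<delta> > 0"
    using \<delta>(1) by (simp add: add_pos_pos)
  have \<epsilon>: "\<epsilon> > 0" "\<epsilon> \<le> 1 / 2" "\<epsilon> \<le> \<delta>\<^sup>2 / 16" "\<epsilon> \<le> r / (1 + 4 / \<delta>)"
  proof -
    show "\<epsilon> > 0"
      using \<delta>(1) r pos by (simp add: \<epsilon>_def)
    show "\<epsilon> \<le> 1 / 2" "\<epsilon> \<le> \<delta>\<^sup>2 / 16" "\<epsilon> \<le> r / (1 + 4 / \<delta>)"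
      unfolding \<epsilon>_def by (meson min.cobounded1 min.cobounded2 order_trans)+
  qed
  have \<epsilon>r: "\<epsilon> + 4 * \<epsilon> / \<delta> \<le> r"
    using \<epsilon>(4) pos by (simp add: le_divide_eq algebra_simps)
  obtain g where g: "g \<in> \<Gamma>" "norm (g 0 - x) < \<epsilon>" "norm (inverse_map g 0 - x) \<ge> \<delta>"
    using \<delta>(2)[OF \<epsilon>(1)] by blast
  define w where "w = inverse_map g 0"
  have N: "1 - (norm w)\<^sup>2 \<le> 2 * \<epsilon>"
    using one_minus_norm_zero_le[OF g(1) x] g(2) by (simp add: w_def)
  define J where "J = sphere 0 1 \<inter> cball x r"
  have far: "norm (u - w) \<ge> \<delta> / 2" if "u \<in> J" for u
  proof -
    have "norm (u - x) \<le> \<delta> / 2"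
      using that r(3) by (simp add: J_def dist_norm norm_minus_commute)
    moreover have "norm (w - x) \<le> norm (u - w) + norm (u - x)"
      by (rule norm_diff_triangle_le[OF _ order_refl]) (simp add: norm_minus_commute)
    ultimately show ?thesis
      using g(3) by (simp add: w_def)
  qed
  have into: "g ` J \<subseteq> J"
  proof (rule image_subsetI)
    fix u assume u: "u \<in> J"
    have "norm (g u - g 0) * (\<delta> / 2) \<le> norm (g u - g 0) * norm (u - w)"
      using far[OF u] by (intro mult_left_mono) auto
    also have "\<dots> = 1 - (norm w)\<^sup>2"
      using dist_images[OF g(1), of u 0] u
      by (simp add: J_def norm_one_minus_cnj_mult w_def)
    finally have "norm (g u - g 0) \<le> 4 * \<epsilon> / \<delta>"
      using N \<delta>(1) by (simp add: field_simps)
    moreover have "norm (g u - x) \<le> norm (g u - g 0) + norm (g 0 - x)"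
      by (rule norm_diff_triangle_le[OF order_refl order_refl])
    ultimately have "norm (g u - x) \<le> r"
      using \<epsilon>r g(2) by linarith
    then show "g u \<in> J"
      using maps_circle[OF g(1), of u] u by (simp add: J_def dist_norm norm_minus_commute)
  qed
  have contr: "dist (g u) (g v) \<le> 1 / 2 * dist u v" if uv: "u \<in> J" "v \<in> J" for u v
  proof -
    have "norm (g u - g v) * (\<delta> / 2 * (\<delta> / 2)) \<le> norm (g u - g v) * (norm (u - w) * norm (v - w))"
      using far uv \<delta>(1) by (intro mult_left_mono mult_mono) auto
    also have "\<dots> = norm (u - v) * (1 - (norm w)\<^sup>2)"
      using dist_images[OF g(1), of u v] uv
      by (simp add: J_def norm_one_minus_cnj_mult w_def mult.assoc)
    also have "\<dots> \<le> norm (u - v) * (2 * (\<delta>\<^sup>2 / 16))"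
      using N \<epsilon>(3) by (intro mult_left_mono) auto
    finally have "norm (g u - g v) * \<delta>\<^sup>2 \<le> (norm (u - v) / 2) * \<delta>\<^sup>2"
      by (simp add: power2_eq_square mult_ac)
    then show ?thesis
      using \<delta>(1) by (simp add: dist_norm mult_le_cancel_right)
  qed
  have "complete J" "J \<noteq> {}"
    using x r(1) unfolding J_def by (auto intro!: closed_Int simp: complete_eq_closed)
  from Banach_fix[OF this _ _ into contr] obtain a where a: "a \<in> J" "g a = a"
    by auto
  have "g 0 \<noteq> 0"
    using g(2) \<epsilon>(2) x by auto
  then show ?thesis
    using that[of a g] a g(1) r(2) by (auto simp: J_def dist_norm norm_minus_commute)
qed

text \<open>
  A point that is not itself flexible is a limit point moved by some element, so the previous lemma
  supplies a flexible point nearby.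
\<close>

lemma flexible_points_dense:
  assumes G: "open G" "x \<in> G" "x \<in> sphere 0 1"
  obtains a where "a \<in> G" "flexible_point a"
proof (cases "flexible_point x")
  case True
  then show ?thesis
    using that G by blast
next
  case False
  then have lim: "limit_point \<Gamma> x" and nofix: "\<And>h. h \<in> \<Gamma> \<Longrightarrow> h 0 \<noteq> 0 \<Longrightarrow> h x \<noteq> x"
    using G(3) by (auto simp: flexible_point_def)
  obtain g1 where g1: "g1 \<in> \<Gamma>" "norm (g1 0 - x) < 1"
    using orbit_of_0_near_limit_point[OF lim zero_less_one] by blast
  have "g1 0 \<noteq> 0"
  proof
    assume "g1 0 = 0"
    then show False
      using g1(2) G(3) by simp
  qed
  then have "g1 x \<noteq> x"
    by (rule nofix[OF g1(1)])
  obtain \<rho> where \<rho>: "\<rho> > 0" "cball x \<rho> \<subseteq> G"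
    using G(1,2) open_contains_cball by blast
  obtain a h where "a \<in> sphere 0 1" "norm (a - x) \<le> \<rho>" "h \<in> \<Gamma>" "h a = a" "h 0 \<noteq> 0"
    using fixed_point_near_limit_point[OF lim g1(1) \<open>g1 x \<noteq> x\<close> \<rho>(1)] by blast
  moreover from this have "a \<in> G"
    using \<rho>(2) by (auto simp: dist_norm norm_minus_commute)
  ultimately show ?thesis
    using that unfolding flexible_point_def by blast
qed

section \<open>Separating arcs and the theorem\<close>

lemma arc_with_flexible_ends:
  assumes W: "circle_neighborhood W p" and p: "p \<in> sphere 0 1"
  obtains U where "circle_neighborhood U p" "connected U" "U \<subseteq> W" "finite (closure U - U)"
    "\<And>a. a \<in> closure U - U \<Longrightarrow> flexible_point a"
proof -
  \<comment> \<open>In the coordinate at the antipode of \<open>p\<close>, the point \<open>p\<close> is the origin of the line.\<close>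
  define q where "q = - p"
  have q: "q \<in> sphere 0 1"
    using p by (simp add: q_def)
  have p0: "circle_point q 0 = p"
    by (simp add: circle_point_def q_def complex_eq_iff Re_divide Im_divide power2_eq_square)
  obtain G where G: "open G" "W = sphere 0 1 \<inter> G"
    using W by (auto simp: circle_neighborhood_def openin_open)
  have "open (circle_point q -` G)"
    using continuous_on_circle_point[of UNIV q] G(1) continuous_on_open_vimage[of UNIV] by auto
  moreover have "0 \<in> circle_point q -` G"
    using W p0 G by (auto simp: circle_neighborhood_def)
  ultimately obtain \<eta> where \<eta>: "\<eta> > 0" "ball 0 \<eta> \<subseteq> circle_point q -` G"
    using open_contains_ball by blast
  have flex: "\<exists>t. l < t \<and> t < u \<and> flexible_point (circle_point q t)" if "l < u" for l u :: real
  proof -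
    let ?m = "(l + u) / 2"
    obtain G' where G': "open G'" "{z \<in> sphere 0 1 - {q}. 1 * circle_coord q z \<in> {l<..<u}} = sphere 0 1 \<inter> G'"
      using openin_circle_coord[of "{l<..<u}" q 1] by (auto simp: openin_open)
    have "circle_point q ?m \<in> {z \<in> sphere 0 1 - {q}. 1 * circle_coord q z \<in> {l<..<u}}"
      using circle_point_in_circle[OF q] circle_coord_circle_point[OF q] that by auto
    then have "circle_point q ?m \<in> sphere 0 1 \<inter> G'"
      unfolding G'(2) .
    then have "circle_point q ?m \<in> G'" "circle_point q ?m \<in> sphere 0 1"
      by blast+
    then obtain a where a: "a \<in> G'" "flexible_point a"
      using flexible_points_dense[OF G'(1)] by blast
    then have "a \<in> sphere 0 1 \<inter> G'"
      by (simp add: flexible_point_def)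
    then have "a \<in> {z \<in> sphere 0 1 - {q}. 1 * circle_coord q z \<in> {l<..<u}}"
      unfolding G'(2) .
    then have c: "a \<in> sphere 0 1" "a \<noteq> q" "l < circle_coord q a" "circle_coord q a < u"
      by simp_all
    have "flexible_point (circle_point q (circle_coord q a))"
      using a(2) circle_point_circle_coord[OF q c(1,2)] by simp
    then show ?thesis
      using c(3,4) by blast
  qed
  obtain t1 where t1: "- \<eta> < t1" "t1 < 0" "flexible_point (circle_point q t1)"
    using flex[of "- \<eta>" 0] \<eta>(1) by auto
  obtain t2 where t2: "0 < t2" "t2 < \<eta>" "flexible_point (circle_point q t2)"
    using flex[of 0 \<eta>] \<eta>(1) by auto
  define U where "U = circle_point q ` {t1<..<t2}"
  have U: "U = {z \<in> sphere 0 1 - {q}. 1 * circle_coord q z \<in> {t1<..<t2}}"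
    using circle_point_image[OF q, of 1 "{t1<..<t2}"] by (simp add: U_def)
  have "closure U \<subseteq> circle_point q ` {t1..t2}"
    unfolding U_def by (intro closure_minimal image_mono compact_imp_closed compact_continuous_image
        continuous_on_circle_point) auto
  moreover have "{t1..t2} = {t1<..<t2} \<union> {t1, t2}"
    using t1 t2 by auto
  ultimately have cl: "closure U - U \<subseteq> {circle_point q t1, circle_point q t2}"
    unfolding U_def by auto
  show ?thesis
  proof
    show "circle_neighborhood U p"
      unfolding circle_neighborhood_def
    proof
      show "openin (top_of_set (sphere 0 1)) U"
        unfolding U by (rule openin_circle_coord) simp
      show "p \<in> U"
        unfolding U_def using t1 t2 p0 by force
    qed
    show "connected U"
      unfolding U_def by (intro connected_continuous_image continuous_on_circle_point) simp
    show "U \<subseteq> W"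
    proof
      fix z assume z: "z \<in> U"
      then obtain t where t: "z = circle_point q t" "t1 < t" "t < t2"
        by (auto simp: U_def)
      then have "t \<in> ball 0 \<eta>"
        using t1 t2 by simp
      then show "z \<in> W"
        using \<eta>(2) t G(2) circle_point_in_circle[OF q] by blast
    qed
    show "finite (closure U - U)"
      using cl finite_subset by blast
    show "flexible_point a" if "a \<in> closure U - U" for a
      using that cl t1(3) t2(3) by blast
  qed
qed

end

lemma closure_complement_subset:
  assumes "openin (top_of_set S) U" "closed S"
  shows "closure (S - closure U) - (S - closure U) \<subseteq> closure U - U"
proof -
  obtain G where G: "open G" "U = S \<inter> G"
    using assms(1) by (auto simp: openin_open)
  have "closure (S - closure U) \<subseteq> S - G"
    using G assms(2) closure_subset[of U] by (intro closure_minimal closed_Diff) auto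
  then show ?thesis
    using G by blast
qed

theorem proposition3p1:
  fixes \<Gamma> :: "(complex \<Rightarrow> complex) set" and p :: complex
  assumes "fuchsian_group \<Gamma>"
    and "p \<in> sphere 0 1"
    and "geodesic_separation_point \<Gamma> p"
  shows "conical_limit_point \<Gamma> p"
proof (rule ccontr)
  interpret fuchsian \<Gamma>
    by unfold_locales (rule assms(1))
  assume "\<not> conical_limit_point \<Gamma> p"
  moreover have "limit_point \<Gamma> p"
    using assms(3) by (simp add: geodesic_separation_point_def)
  ultimately have nc: "nonconical_at p"
    by (intro nonconical_atI)
  obtain W where W: "circle_neighborhood W p"
    "\<And>U. circle_neighborhood U p \<Longrightarrow> connected U \<Longrightarrow> U \<subseteq> W \<Longrightarrow>
       can_be_concentrated \<Gamma> U p \<or> can_be_concentrated \<Gamma> (sphere 0 1 - closure U) p"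
    using assms(3) unfolding geodesic_separation_point_def by blast
  obtain U where U: "circle_neighborhood U p" "connected U" "U \<subseteq> W" "finite (closure U - U)"
    "\<And>a. a \<in> closure U - U \<Longrightarrow> flexible_point a"
    using arc_with_flexible_ends[OF W(1) assms(2)] by blast
  have oU: "openin (top_of_set (sphere 0 1)) U"
    using U(1) by (simp add: circle_neighborhood_def)
  let ?U' = "sphere 0 1 - closure U"
  have oU': "openin (top_of_set (sphere 0 1)) ?U'"
    by (metis Diff_eq closed_closure openin_open open_Compl)
  have sub: "closure ?U' - ?U' \<subseteq> closure U - U"
    by (rule closure_complement_subset[OF oU]) simp
  have "\<not> can_be_concentrated \<Gamma> U p"
    by (rule no_concentration_at_nonconical_point[OF nc assms(2) oU U(4,5)])
  moreover have "\<not> can_be_concentrated \<Gamma> ?U' p"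
    by (rule no_concentration_at_nonconical_point[OF nc assms(2) oU'])
      (use sub U(4,5) in \<open>auto intro: finite_subset\<close>)
  ultimately show False
    using W(2)[OF U(1-3)] by blast
qed

end
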